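(* (Lower bound.) For any $\alpha\in(0,1/4)$ there exists a constant $c>0$ depending only on $\alpha$ such that for all integers $n,m\ge1$, $\epsilon\in[0,1]$ and $p\in[0,1]$, $$r_\alpha(\epsilon,p,\epsilon)\ \ge\ c\left[\sqrt{\frac{p(1-p)}m}\Big(\frac1{\sqrt n}+\epsilon\Big)+\frac1m\Big(\frac1n+\epsilon\Big)\right].$$ (Upper bound.) There is a universal constant $c_0>0$ and, for every $\alpha\in(0,1)$, a constant $C>0$ depending only on $\alpha$ such that for all integers $n,m\ge1$ and $\epsilon\in[0,1]$ with $\frac{\log(2/\alpha)}n+\epsilon\le c_0$, there is a confidence interval $\widehat{\mathrm{CI}}$ computed from $X_1,\dots,X_n$ (its construction may depend on $\epsilon$) satisfying $$\inf_{p,Q}P_{\epsilon,p,Q}\big(p\in\widehat{\mathrm{CI}}\big)\ge1-\alpha,$$ $$\inf_{p,Q}P_{\epsilon,p,Q}\left(|\widehat{\mathrm{CI}}|\le C\left[\sqrt{\frac{p(1-p)}m}\Big(\frac1{\sqrt n}+\epsilon\Big)+\frac1m\Big(\frac1n+\epsilon\Big)\right]\right)\ge1-\alpha.$$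
   Context: Let $n,m\ge 1$ be integers. For $\epsilon,p\in[0,1]$ and a probability distribution $Q$ on $\mathbb R$ put $P_{\epsilon,p,Q}=(1-\epsilon)\,\mathrm{Binomial}(m,p)+\epsilon Q$. The data $X_1,\dots,X_n$ are i.i.d. from $P_{\epsilon,p,Q}$, and $P_{\epsilon,p,Q}(E)$ denotes the probability of an event $E$ about $(X_1,\dots,X_n)$ under $P_{\epsilon,p,Q}^{\otimes n}$. Suprema and infima over $Q$ range over all probability distributions, over $p$ over $[0,1]$. An interval $[L,U]$ has length $|[L,U]|=U-L$ if $U\ge L$, and is empty (of length $0$) if $U<L$. Class of confidence intervals (for an upper bound $\epsilon_{\max}$ on the contamination proportion): $$\mathcal I_\alpha(\epsilon_{\max})=\Big\{\widehat{\mathrm{CI}}=[l(\{X_i\}_{i=1}^n),u(\{X_i\}_{i=1}^n)]:\ \inf_{p,Q}P_{\epsilon_{\max},p,Q}\big(p\in\widehat{\mathrm{CI}}\big)\ge 1-\alpha\Big\}.$$ Locally optimal length: $$r_\alpha(\epsilon,p,\epsilon_{\max})=\inf\Big\{r\ge0:\ \inf_{\widehat{\mathrm{CI}}\in\mathcal I_\alpha(\epsilon_{\max})}\ \sup_Q P_{\epsilon,p,Q}\big(|\widehat{\mathrm{CI}}|\ge r\big)\le\alpha\Big\};$$ the claim concerns $\epsilon_{\max}=\epsilon$. *)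

theory Defs
  imports "HOL-Probability.Probability"
begin

definition binomial_distr :: "nat \<Rightarrow> real \<Rightarrow> real measure" where
  "binomial_distr m p = distr (measure_pmf (binomial_pmf m p)) borel real"

definition contam :: "nat \<Rightarrow> real \<Rightarrow> real \<Rightarrow> real measure \<Rightarrow> real measure" where
  "contam m \<epsilon> p Q = measure_of UNIV (sets borel)
     (\<lambda>A. ennreal (1 - \<epsilon>) * emeasure (binomial_distr m p) A + ennreal \<epsilon> * emeasure Q A)"

text \<open>Samples \<open>(X\<^sub>1, \<dots>, X\<^sub>n)\<close> are functions on the index set \<open>{..<n}\<close>.\<close>

definition sample_distr :: "nat \<Rightarrow> nat \<Rightarrow> real \<Rightarrow> real \<Rightarrow> real measure \<Rightarrow> (nat \<Rightarrow> real) measure" where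
  "sample_distr n m \<epsilon> p Q = PiM {..<n} (\<lambda>_. contam m \<epsilon> p Q)"

definition Prob :: "nat \<Rightarrow> nat \<Rightarrow> real \<Rightarrow> real \<Rightarrow> real measure \<Rightarrow> ((nat \<Rightarrow> real) \<Rightarrow> bool) \<Rightarrow> real" where
  "Prob n m \<epsilon> p Q E = measure (sample_distr n m \<epsilon> p Q) {x \<in> space (sample_distr n m \<epsilon> p Q). E x}"

type_synonym interval_fn = "((nat \<Rightarrow> real) \<Rightarrow> real) \<times> ((nat \<Rightarrow> real) \<Rightarrow> real)"

text \<open>An interval-valued statistic is the pair \<open>(l, u)\<close> of its measurable endpoints; the interval
  is \<open>{l x..u x}\<close>, empty when \<open>u x < l x\<close>.\<close>

definition intervals :: "nat \<Rightarrow> interval_fn set" where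
  "intervals n = {CI. fst CI \<in> borel_measurable (PiM {..<n} (\<lambda>_. borel)) \<and>
                      snd CI \<in> borel_measurable (PiM {..<n} (\<lambda>_. borel))}"

definition interval_at :: "interval_fn \<Rightarrow> (nat \<Rightarrow> real) \<Rightarrow> real set" where
  "interval_at CI x = {fst CI x..snd CI x}"

definition interval_len :: "interval_fn \<Rightarrow> (nat \<Rightarrow> real) \<Rightarrow> real" where
  "interval_len CI x = (if fst CI x \<le> snd CI x then snd CI x - fst CI x else 0)"

abbreviation distributions :: "real measure set" where
  "distributions \<equiv> {Q. real_distribution Q}"

definition ci_class :: "nat \<Rightarrow> nat \<Rightarrow> real \<Rightarrow> real \<Rightarrow> interval_fn set" where
  "ci_class n m \<alpha> \<epsilon>max = {CI \<in> intervals n.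
     (INF (p, Q) \<in> {0..1} \<times> distributions. Prob n m \<epsilon>max p Q (\<lambda>x. p \<in> interval_at CI x)) \<ge> 1 - \<alpha>}"

definition opt_length :: "nat \<Rightarrow> nat \<Rightarrow> real \<Rightarrow> real \<Rightarrow> real \<Rightarrow> real \<Rightarrow> real" where
  "opt_length n m \<alpha> \<epsilon> p \<epsilon>max = Inf {r. r \<ge> 0 \<and>
     (INF CI \<in> ci_class n m \<alpha> \<epsilon>max. SUP Q \<in> distributions.
        Prob n m \<epsilon> p Q (\<lambda>x. interval_len CI x \<ge> r)) \<le> \<alpha>}"

definition rate :: "nat \<Rightarrow> nat \<Rightarrow> real \<Rightarrow> real \<Rightarrow> real" where
  "rate n m \<epsilon> p = sqrt (p * (1 - p) / real m) * (1 / sqrt (real n) + \<epsilon>)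
                   + 1 / real m * (1 / real n + \<epsilon>)"

lemma real_distribution_binomial_distr: "real_distribution (binomial_distr m p)"
  unfolding binomial_distr_def
  by (rule prob_space.real_distribution_distr) (simp_all add: prob_space_measure_pmf)

lemma sets_contam [simp, measurable_cong]: "sets (contam m \<epsilon> p Q) = sets borel"
  by (simp add: contam_def) (metis sets.sigma_sets_eq space_borel)

lemma space_contam [simp]: "space (contam m \<epsilon> p Q) = UNIV"
  using sets_eq_imp_space_eq[OF sets_contam] by simp

lemma emeasure_contam:
  assumes Q: "real_distribution Q" and A: "A \<in> sets borel"
  shows "emeasure (contam m \<epsilon> p Q) A =
           ennreal (1 - \<epsilon>) * emeasure (binomial_distr m p) A + ennreal \<epsilon> * emeasure Q A"
proof -
  let ?f = "\<lambda>A. ennreal (1 - \<epsilon>) * emeasure (binomial_distr m p) A + ennreal \<epsilon> * emeasure Q A"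
  have sQ: "sets Q = sets borel" and sB: "sets (binomial_distr m p) = sets borel"
    using Q real_distribution_binomial_distr[of m p]
    by (auto simp: real_distribution_def real_distribution_axioms_def)
  have "countably_additive (sets borel) ?f"
    unfolding countably_additive_def
  proof (intro allI impI)
    fix F :: "nat \<Rightarrow> real set"
    assume F: "range F \<subseteq> sets borel" "disjoint_family F"
    have "(\<Sum>i. ?f (F i)) = ennreal (1 - \<epsilon>) * (\<Sum>i. emeasure (binomial_distr m p) (F i))
                            + ennreal \<epsilon> * (\<Sum>i. emeasure Q (F i))"
      by (simp add: suminf_add[symmetric])
    then show "(\<Sum>i. ?f (F i)) = ?f (\<Union> (range F))"
      using F by (simp add: suminf_emeasure sQ sB)
  qed
  moreover have "positive (sets borel) ?f"
    by (simp add: positive_def)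
  moreover have "sets borel \<subseteq> Pow (UNIV :: real set)" by simp
  moreover have "A \<in> sets (contam m \<epsilon> p Q)" using A by simp
  ultimately show ?thesis
    by (intro emeasure_measure_of[OF contam_def]) simp_all
qed

lemma real_distribution_contam:
  assumes Q: "real_distribution Q" and e: "\<epsilon> \<in> {0..1}"
  shows "real_distribution (contam m \<epsilon> p Q)"
proof -
  interpret Q: real_distribution Q by fact
  interpret B: real_distribution "binomial_distr m p" by (rule real_distribution_binomial_distr)
  have "emeasure (contam m \<epsilon> p Q) UNIV = ennreal (1 - \<epsilon>) + ennreal \<epsilon>"
    using Q.emeasure_space_1 B.emeasure_space_1 by (simp add: emeasure_contam Q)
  also have "\<dots> = 1"
    using e by (simp flip: ennreal_plus)
  finally show ?thesis
    by (auto simp: real_distribution_def real_distribution_axioms_def intro!: prob_spaceI)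
qed

lemma prob_space_sample_distr:
  assumes "real_distribution Q" "\<epsilon> \<in> {0..1}"
  shows "prob_space (sample_distr n m \<epsilon> p Q)"
  unfolding sample_distr_def
  by (intro prob_space_PiM) (use real_distribution_contam[OF assms] in \<open>auto simp: real_distribution_def\<close>)

lemma distributions_nonempty: "distributions \<noteq> {}"
  using real_distribution_binomial_distr by blast

text \<open>The class of confidence intervals is nonempty, so the infimum over it is not vacuous.\<close>

lemma unit_interval_in_ci_class:
  assumes "\<alpha> \<ge> 0" "\<epsilon> \<in> {0..1}"
  shows "((\<lambda>_. 0), (\<lambda>_. 1)) \<in> ci_class n m \<alpha> \<epsilon>"
proof -
  have "Prob n m \<epsilon> p Q (\<lambda>x. p \<in> interval_at ((\<lambda>_. 0), (\<lambda>_. 1)) x) = 1"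
    if "p \<in> {0..1}" "real_distribution Q" for p Q
    using that prob_space.prob_space[OF prob_space_sample_distr[OF that(2) assms(2)]]
    by (simp add: Prob_def interval_at_def)
  then have "(INF (p, Q) \<in> {0..1} \<times> distributions.
      Prob n m \<epsilon> p Q (\<lambda>x. p \<in> interval_at ((\<lambda>_. 0), (\<lambda>_. 1)) x)) \<ge> 1 - \<alpha>"
    using assms(1) distributions_nonempty by (intro cINF_greatest) auto
  then show ?thesis
    by (simp add: ci_class_def intervals_def)
qed

end

theory Submission
  imports Defs
begin

text \<open>
  \<^bold>\<open>Lower bound.\<close> Suppose that \<open>p\<close> and \<open>p'\<close> admit contaminations \<open>Q\<close> and \<open>Q'\<close> under which the two
  samples assign to every event probabilities that differ by at most \<open>\<eta>\<close>. An interval with coverage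
  \<open>1 - \<alpha>\<close> then contains \<open>p\<close> and \<open>p'\<close> simultaneously with probability at least \<open>1 - 2\<alpha> - \<eta>\<close> under
  \<open>(p, Q)\<close>, so its length is at least \<open>\<bar>p - p'\<bar>\<close> there; as \<open>3\<alpha> + \<eta> < 1\<close> this bounds the optimal length
  below (lemma \<open>opt_length_ge_two_point\<close>). Each of the four terms of the rate comes from one choice of
  \<open>p'\<close>, obtained by moving \<open>p\<close> towards \<open>1/2\<close>. For the terms without \<open>\<epsilon>\<close> the contaminations are the
  binomial laws themselves, so that both samples are uncontaminated: the term \<open>\<surd>(p(1-p)/(mn))\<close> follows
  from a chi-square estimate, and \<open>1/(mn)\<close> from the pointwise minorization of one binomial law by a
  multiple of the other. For the two terms with \<open>\<epsilon>\<close> the binomial laws of \<open>p\<close> and \<open>p'\<close> are within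
  total variation distance \<open>\<epsilon>\<close>, and then the contaminations can be chosen to make the two mixtures
  equal.

  \<^bold>\<open>Upper bound.\<close> The interval is the hull of the values accepted by a family of tests. In the
  variance-stabilising coordinate \<open>\<theta> = arcsin \<surd>p\<close> a binomial proportion concentrates around its
  parameter at scale \<open>1/\<surd>m\<close>, whatever \<open>p\<close> is. The range \<open>[0, \<pi>/2]\<close> of \<open>\<theta>\<close> is divided into cells of
  width \<open>h = 128/\<surd>m\<close>, and the cell \<open>j\<close> carries a window: a function of the observation with values in
  \<open>[0,1]\<close> which increases linearly in \<open>\<theta>\<close> over the cell and its surroundings. A value \<open>p\<close> is tested by
  comparing the empirical mean of the window of its own cell with the mean of this window under the
  binomial law. Contamination moves the mean of a \<open>[0,1]\<close>-valued statistic by at most \<open>\<epsilon>\<close>, and an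
  exponential-moment bound controls the fluctuations in terms of \<open>min \<mu> (1 - \<mu>)\<close>, which for a window is
  at most \<open>2mp(1-p)\<close>.

  Coverage of \<open>p\<close> involves a single test. For the length, the five windows closest to \<open>p\<close> suffice. The
  windows decrease with the index of the cell, so a value at least two cells away is rejected because
  the relevant means differ by more than \<open>1/8\<close> (\<open>window_mean_separation_below\<close>,
  \<open>window_mean_separation_above\<close>), while the smallness of \<open>log(2/\<alpha>)/n + \<epsilon>\<close> keeps every tolerated
  deviation below \<open>1/16\<close>. In the remaining cells the derivative of the mean with respect to
  \<open>p\<close> is at least \<open>1/(8h(sin 2\<theta> + h))\<close> (\<open>window_mean_deriv_ge\<close>), and since
  \<open>sin 2\<theta> = 2\<surd>(p(1-p))\<close>, this turns the width of the acceptance region into the claimed rate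
  (\<open>accepted_close\<close>).
\<close>

section \<open>Laws supported on finitely many integers\<close>

text \<open>
  The law on the real line that gives mass \<open>w k\<close> to the integer \<open>k\<close>, for \<open>k \<le> m\<close>.
\<close>

definition finite_law :: "nat \<Rightarrow> (nat \<Rightarrow> real) \<Rightarrow> real measure" where
  "finite_law m w = distr (point_measure {..m} (\<lambda>k. ennreal (w k))) borel real"

lemma sets_finite_law [simp, measurable_cong]: "sets (finite_law m w) = sets borel"
  by (simp add: finite_law_def)

lemma space_finite_law [simp]: "space (finite_law m w) = UNIV"
  by (simp add: finite_law_def)

lemma emeasure_finite_law:
  assumes "\<And>k. k \<le> m \<Longrightarrow> w k \<ge> 0" "A \<in> sets borel"
  shows "emeasure (finite_law m w) A = ennreal (\<Sum>k\<le>m. w k * indicator A (real k))"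
proof -
  have "emeasure (finite_law m w) A
      = emeasure (point_measure {..m} (\<lambda>k. ennreal (w k))) (real -` A \<inter> {..m})"
    unfolding finite_law_def using assms(2) by (subst emeasure_distr) (auto simp: space_point_measure)
  also have "\<dots> = (\<Sum>k\<in>real -` A \<inter> {..m}. ennreal (w k))"
    by (rule emeasure_point_measure_finite) auto
  also have "\<dots> = ennreal (\<Sum>k\<in>real -` A \<inter> {..m}. w k)"
    using assms(1) by (intro sum_ennreal) auto
  also have "(\<Sum>k\<in>real -` A \<inter> {..m}. w k) = (\<Sum>k\<le>m. w k * indicator A (real k))"
    by (intro sum.mono_neutral_cong_left) (auto simp: indicator_def)
  finally show ?thesis .
qed

lemma real_distribution_finite_law:
  assumes "\<And>k. k \<le> m \<Longrightarrow> w k \<ge> 0" "(\<Sum>k\<le>m. w k) = 1"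
  shows "real_distribution (finite_law m w)"
proof -
  have "emeasure (finite_law m w) (space (finite_law m w)) = 1"
    using emeasure_finite_law[of m w UNIV] assms by simp
  then show ?thesis
    by (auto simp: real_distribution_def real_distribution_axioms_def intro!: prob_spaceI)
qed

lemma binomial_distr_eq_finite_law:
  assumes p: "p \<in> {0..1}"
  shows "binomial_distr m p = finite_law m (\<lambda>k. Bernstein m k p)"
proof (rule measure_eqI)
  show "sets (binomial_distr m p) = sets (finite_law m (\<lambda>k. Bernstein m k p))"
    by (simp add: binomial_distr_def)
  fix A assume "A \<in> sets (binomial_distr m p)"
  then have A: "A \<in> sets borel" by (simp add: binomial_distr_def)
  have "emeasure (binomial_distr m p) A = emeasure (measure_pmf (binomial_pmf m p)) (real -` A)"
    unfolding binomial_distr_def using A by (subst emeasure_distr) auto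
  also have "\<dots> = emeasure (measure_pmf (binomial_pmf m p)) (real -` A \<inter> {..m})"
    using p by (intro emeasure_eq_AE)
      (auto simp: AE_measure_pmf_iff set_pmf_binomial_eq split: if_splits)
  also have "\<dots> = ennreal (\<Sum>k\<in>real -` A \<inter> {..m}. pmf (binomial_pmf m p) k)"
    by (subst emeasure_measure_pmf_finite) (auto intro!: sum_ennreal)
  also have "(\<Sum>k\<in>real -` A \<inter> {..m}. pmf (binomial_pmf m p) k)
      = (\<Sum>k\<in>real -` A \<inter> {..m}. Bernstein m k p)"
    using p by (intro sum.cong) (auto simp: Bernstein_def)
  also have "\<dots> = (\<Sum>k\<le>m. Bernstein m k p * indicator A (real k))"
    by (intro sum.mono_neutral_cong_left) (auto simp: indicator_def)
  also have "ennreal \<dots> = emeasure (finite_law m (\<lambda>k. Bernstein m k p)) A"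
    using p A by (subst emeasure_finite_law) (auto intro: Bernstein_nonneg)
  finally show "emeasure (binomial_distr m p) A = emeasure (finite_law m (\<lambda>k. Bernstein m k p)) A" .
qed

lemma contam_finite_law:
  assumes p: "p \<in> {0..1}" and e: "\<epsilon> \<in> {0..1}"
    and w: "\<And>k. k \<le> m \<Longrightarrow> w k \<ge> 0" "(\<Sum>k\<le>m. w k) = 1"
  shows "contam m \<epsilon> p (finite_law m w)
       = finite_law m (\<lambda>k. (1 - \<epsilon>) * Bernstein m k p + \<epsilon> * w k)"
proof (rule measure_eqI)
  fix A assume "A \<in> sets (contam m \<epsilon> p (finite_law m w))"
  then have A: "A \<in> sets borel" by simp
  have b: "0 \<le> Bernstein m k p" for k using p by (auto intro: Bernstein_nonneg)
  have s: "0 \<le> (\<Sum>k\<le>m. Bernstein m k p * indicator A (real k))"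
      "0 \<le> (\<Sum>k\<le>m. w k * indicator A (real k))"
    using b w by (auto intro!: sum_nonneg)
  have "emeasure (contam m \<epsilon> p (finite_law m w)) A
      = ennreal (1 - \<epsilon>) * ennreal (\<Sum>k\<le>m. Bernstein m k p * indicator A (real k))
        + ennreal \<epsilon> * ennreal (\<Sum>k\<le>m. w k * indicator A (real k))"
    using A w b p by (simp add: emeasure_contam real_distribution_finite_law
        emeasure_finite_law binomial_distr_eq_finite_law)
  also have "\<dots> = ennreal ((1 - \<epsilon>) * (\<Sum>k\<le>m. Bernstein m k p * indicator A (real k))
        + \<epsilon> * (\<Sum>k\<le>m. w k * indicator A (real k)))"
    by (subst ennreal_plus) (use e s in \<open>auto simp: ennreal_mult' simp del: sum_mult_indicator intro!: mult_nonneg_nonneg\<close>)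
  also have "\<dots> = emeasure (finite_law m (\<lambda>k. (1 - \<epsilon>) * Bernstein m k p + \<epsilon> * w k)) A"
    using A w b e
    by (subst emeasure_finite_law)
       (auto simp: distrib_right sum.distrib sum_distrib_left mult.assoc
             simp del: sum_mult_indicator intro!: add_nonneg_nonneg mult_nonneg_nonneg)
  finally show "emeasure (contam m \<epsilon> p (finite_law m w)) A
    = emeasure (finite_law m (\<lambda>k. (1 - \<epsilon>) * Bernstein m k p + \<epsilon> * w k)) A" .
qed simp

text \<open>
  A sample from such a law is discrete too, so the probability of an event is a finite sum over the
  index functions \<open>f\<close> with values in \<open>{..m}\<close>.
\<close>

lemma measure_PiM_finite_law:
  fixes n :: nat
  assumes w: "\<And>k. k \<le> m \<Longrightarrow> w k \<ge> 0" "(\<Sum>k\<le>m. w k) = 1"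
    and A: "A \<in> sets (PiM {..<n} (\<lambda>_. borel))"
  shows "measure (PiM {..<n} (\<lambda>_. finite_law m w)) A
       = (\<Sum>f\<in>PiE {..<n} (\<lambda>_. {..m}). (\<Prod>i<n. w (f i)) * indicator A (\<lambda>i\<in>{..<n}. real (f i)))"
proof -
  let ?N = "PiM {..<n} (\<lambda>_. finite_law m w)"
  let ?F = "PiE {..<n} (\<lambda>_. {..m})"
  let ?x = "\<lambda>f. (\<lambda>i\<in>{..<n}. real (f i))"
  interpret L: prob_space "finite_law m w"
    using real_distribution_finite_law[OF w] by (simp add: real_distribution_def)
  interpret P: product_prob_space "\<lambda>_::nat. finite_law m w" ..
  interpret N: prob_space ?N by (intro prob_space_PiM) (rule L.prob_space_axioms)
  have setsN: "sets ?N = sets (PiM {..<n} (\<lambda>_. borel))" by (intro sets_PiM_cong) auto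
  have finF: "finite ?F" by (intro finite_PiE) auto
  have inj: "inj_on ?x ?F"
  proof (rule inj_onI)
    fix f g assume fg: "f \<in> ?F" "g \<in> ?F" "?x f = ?x g"
    show "f = g"
    proof (rule PiE_ext[OF fg(1,2)])
      fix i assume "i \<in> {..<n}"
      then show "f i = g i" using fun_cong[OF fg(3), of i] by simp
    qed
  qed
  have sing: "{?x f} = PiE {..<n} (\<lambda>i. {real (f i)})" for f
    by (subst PiE_singleton[symmetric, of "?x f" "{..<n}"]) (auto intro!: PiE_cong)
  have atom: "emeasure (finite_law m w) {real k} = ennreal (w k)" if "k \<le> m" for k
    using w(1) that by (subst emeasure_finite_law) (auto simp: indicator_def)
  have ms: "measure ?N {?x f} = (\<Prod>i<n. w (f i))" if "f \<in> ?F" for f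
  proof -
    have "emeasure ?N {?x f} = (\<Prod>i<n. emeasure (finite_law m w) {real (f i)})"
      unfolding sing by (subst P.emeasure_PiM) auto
    also have "\<dots> = (\<Prod>i<n. ennreal (w (f i)))"
      using that by (intro prod.cong) (auto simp: PiE_iff intro!: atom)
    also have "\<dots> = ennreal (\<Prod>i<n. w (f i))"
      using that w(1) by (intro prod_ennreal) (auto simp: PiE_iff)
    finally have e: "emeasure ?N {?x f} = ennreal (\<Prod>i<n. w (f i))" .
    have "0 \<le> (\<Prod>i<n. w (f i))" using that w(1) by (auto simp: PiE_iff intro!: prod_nonneg)
    then show ?thesis unfolding measure_def e by simp
  qed
  have singsets: "{?x f} \<in> sets ?N" for f
    unfolding sing by (intro sets_PiM_I_finite) auto
  have fin: "measure ?N (?x ` G) = (\<Sum>f\<in>G. \<Prod>i<n. w (f i))" if "G \<subseteq> ?F" for G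
  proof -
    have "measure ?N (?x ` G) = (\<Sum>y\<in>?x ` G. measure ?N {y})"
      using that finF singsets by (intro N.finite_measure_eq_sum_singleton) (auto intro: finite_subset)
    also have "\<dots> = (\<Sum>f\<in>G. measure ?N {?x f})"
      using that inj by (subst sum.reindex) (auto intro: inj_on_subset)
    also have "\<dots> = (\<Sum>f\<in>G. \<Prod>i<n. w (f i))" using that by (intro sum.cong) (auto intro!: ms)
    finally show ?thesis .
  qed
  have "measure ?N (?x ` ?F) = (\<Sum>f\<in>?F. \<Prod>i<n. w (f i))" by (rule fin) simp
  also have "\<dots> = (\<Prod>i<n. \<Sum>k\<le>m. w k)" by (rule prod_sum_PiE[symmetric]) auto
  finally have one: "measure ?N (?x ` ?F) = 1" by (simp add: w)
  have setsF: "?x ` G \<in> sets ?N" if "finite G" for G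
  proof -
    have "?x ` G = (\<Union>f\<in>G. {?x f})" by auto
    then show ?thesis using that singsets by (simp only: sets.finite_UN)
  qed
  have "AE y in ?N. y \<in> ?x ` ?F"
    using one setsF[OF finF] by (subst N.AE_in_set_eq_1) auto
  then have "measure ?N A = measure ?N (?x ` {f\<in>?F. ?x f \<in> A})"
    using A finF by (intro N.finite_measure_eq_AE) (auto simp: setsN setsF[unfolded setsN])
  also have "\<dots> = (\<Sum>f\<in>{f\<in>?F. ?x f \<in> A}. \<Prod>i<n. w (f i))" by (rule fin) auto
  also have "\<dots> = (\<Sum>f\<in>?F. (\<Prod>i<n. w (f i)) * indicator A (?x f))"
    using finF by (intro sum.mono_neutral_cong_left) (auto simp: indicator_def)
  finally show ?thesis .
qed

section \<open>Comparing two samples\<close>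

text \<open>
  The chi-square divergence of \<open>w'\<close> from \<open>w\<close> bounds the difference of the means of any function with
  values in \<open>[0,1]\<close>, by the Cauchy-Schwarz inequality.
\<close>

lemma sum_le_sum_plus_chi_square:
  fixes w w' :: "'a \<Rightarrow> real"
  assumes "finite F" and w: "\<And>x. x \<in> F \<Longrightarrow> w x > 0"
    and s: "sum w F = 1" "sum w' F = 1"
    and chi: "(\<Sum>x\<in>F. (w' x)\<^sup>2 / w x) \<le> 1 + \<eta>\<^sup>2" and "\<eta> \<ge> 0"
    and g: "\<And>x. x \<in> F \<Longrightarrow> g x \<in> {0..1}"
  shows "(\<Sum>x\<in>F. w x * g x) \<le> (\<Sum>x\<in>F. w' x * g x) + \<eta>"
proof -
  have eq: "(\<Sum>x\<in>F. (w x - w' x)\<^sup>2 / w x) = (\<Sum>x\<in>F. (w' x)\<^sup>2 / w x) - 1"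
  proof -
    have "(\<Sum>x\<in>F. (w x - w' x)\<^sup>2 / w x) = (\<Sum>x\<in>F. w x - 2 * w' x + (w' x)\<^sup>2 / w x)"
      by (intro sum.cong refl) (use w in \<open>force simp: power2_eq_square field_simps\<close>)
    also have "\<dots> = sum w F - 2 * sum w' F + (\<Sum>x\<in>F. (w' x)\<^sup>2 / w x)"
      by (simp add: sum.distrib sum_subtractf sum_distrib_left)
    finally show ?thesis using s by simp
  qed
  have "(\<Sum>x\<in>F. (w x - w' x) * g x)\<^sup>2
      = (\<Sum>x\<in>F. ((w x - w' x) / sqrt (w x)) * (sqrt (w x) * g x))\<^sup>2"
    by (intro arg_cong[where f="\<lambda>t. t\<^sup>2"] sum.cong refl) (use w in force)
  also have "\<dots> \<le> (\<Sum>x\<in>F. ((w x - w' x) / sqrt (w x))\<^sup>2) * (\<Sum>x\<in>F. (sqrt (w x) * g x)\<^sup>2)"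
    by (rule Cauchy_Schwarz_ineq_sum)
  also have "\<dots> \<le> \<eta>\<^sup>2 * 1"
  proof (intro mult_mono)
    have "(\<Sum>x\<in>F. ((w x - w' x) / sqrt (w x))\<^sup>2) = (\<Sum>x\<in>F. (w x - w' x)\<^sup>2 / w x)"
      by (intro sum.cong refl) (use w in \<open>force simp: power_divide\<close>)
    then show "(\<Sum>x\<in>F. ((w x - w' x) / sqrt (w x))\<^sup>2) \<le> \<eta>\<^sup>2" using eq chi by simp
    have "(\<Sum>x\<in>F. (sqrt (w x) * g x)\<^sup>2) \<le> sum w F"
    proof (rule sum_mono)
      fix x assume x: "x \<in> F"
      have "(sqrt (w x) * g x)\<^sup>2 = w x * (g x)\<^sup>2"
        using w[OF x] by (simp add: power_mult_distrib)
      also have "\<dots> \<le> w x * 1"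
        using w[OF x] g[OF x] by (intro mult_left_mono) (auto simp: power_le_one)
      finally show "(sqrt (w x) * g x)\<^sup>2 \<le> w x" by simp
    qed
    then show "(\<Sum>x\<in>F. (sqrt (w x) * g x)\<^sup>2) \<le> 1" using s by simp
  qed (auto intro!: sum_nonneg)
  finally have "(\<Sum>x\<in>F. (w x - w' x) * g x) \<le> \<eta>"
    using \<open>\<eta> \<ge> 0\<close> by (simp add: power2_le_iff_abs_le)
  then show ?thesis by (simp add: left_diff_distrib sum_subtractf)
qed

lemma sum_Bernstein_chi_square:
  fixes p p' :: real
  assumes "0 < p" "p < 1"
  shows "(\<Sum>k\<le>m. (Bernstein m k p')\<^sup>2 / Bernstein m k p) = (1 + (p' - p)\<^sup>2 / (p * (1 - p))) ^ m"
proof -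
  have "(\<Sum>k\<le>m. (Bernstein m k p')\<^sup>2 / Bernstein m k p)
      = (\<Sum>k\<le>m. of_nat (m choose k) * (p'\<^sup>2 / p) ^ k * ((1 - p')\<^sup>2 / (1 - p)) ^ (m - k))"
  proof (intro sum.cong refl)
    fix k assume "k \<in> {..m}"
    then have "real (m choose k) > 0" by (simp add: zero_less_binomial)
    moreover have "p ^ k > 0" "(1 - p) ^ (m - k) > 0" using assms by auto
    ultimately show "(Bernstein m k p')\<^sup>2 / Bernstein m k p
      = of_nat (m choose k) * (p'\<^sup>2 / p) ^ k * ((1 - p')\<^sup>2 / (1 - p)) ^ (m - k)"
      unfolding Bernstein_def power_divide power_mult_distrib power2_eq_square
      by (simp add: field_simps del: power_eq_0_iff)
  qed
  also have "\<dots> = (p'\<^sup>2 / p + (1 - p')\<^sup>2 / (1 - p)) ^ m"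
    by (rule binomial_ring[symmetric])
  also have "p'\<^sup>2 / p + (1 - p')\<^sup>2 / (1 - p) = 1 + (p' - p)\<^sup>2 / (p * (1 - p))"
    using assms by (simp add: field_simps power2_eq_square)
  finally show ?thesis .
qed

lemma Bernstein_minorization:
  assumes "0 \<le> \<rho>" "\<rho> \<le> 1" "\<rho> * p \<le> p'" "\<rho> * (1 - p) \<le> 1 - p'" "0 \<le> p" "p \<le> 1" "k \<le> m"
  shows "\<rho> ^ m * Bernstein m k p \<le> Bernstein m k p'"
proof -
  have "\<rho> ^ m * Bernstein m k p = of_nat (m choose k) * ((\<rho> * p) ^ k * (\<rho> * (1 - p)) ^ (m - k))"
  proof -
    have "\<rho> ^ m = \<rho> ^ k * \<rho> ^ (m - k)" using assms(7) by (simp flip: power_add)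
    then show ?thesis by (simp add: Bernstein_def power_mult_distrib)
  qed
  also have "\<dots> \<le> of_nat (m choose k) * (p' ^ k * (1 - p') ^ (m - k))"
  proof -
    have "0 \<le> \<rho> * p" "0 \<le> \<rho> * (1 - p)" using assms by auto
    then have "0 \<le> p'" "0 \<le> 1 - p'" using assms(3,4) by linarith+
    with assms show ?thesis by (intro mult_left_mono mult_mono power_mono) auto
  qed
  finally show ?thesis by (simp add: Bernstein_def mult.assoc)
qed

lemma measure_PiM_finite_law_minorization:
  fixes n :: nat
  assumes w: "\<And>k. k \<le> m \<Longrightarrow> w k \<ge> 0" "(\<Sum>k\<le>m. w k) = 1"
    and w': "\<And>k. k \<le> m \<Longrightarrow> w' k \<ge> 0" "(\<Sum>k\<le>m. w' k) = 1"
    and \<rho>: "0 \<le> \<rho>" "\<And>k. k \<le> m \<Longrightarrow> \<rho> * w k \<le> w' k"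
    and A: "A \<in> sets (PiM {..<n} (\<lambda>_. borel))"
  shows "\<rho> ^ n * measure (PiM {..<n} (\<lambda>_. finite_law m w)) A
       \<le> measure (PiM {..<n} (\<lambda>_. finite_law m w')) A"
proof -
  have "measure (PiM {..<n} (\<lambda>_. finite_law m u)) A
       = (\<Sum>f\<in>PiE {..<n} (\<lambda>_. {..m}). (\<Prod>i<n. u (f i)) * indicator A (\<lambda>i\<in>{..<n}. real (f i)))"
    if "u = w \<or> u = w'" for u
    using that w w' A by (intro measure_PiM_finite_law) auto
  note eq = this[of w, simplified] this[of w', simplified]
  show ?thesis
    unfolding eq sum_distrib_left
  proof (rule sum_mono)
    fix f assume f: "f \<in> PiE {..<n} (\<lambda>_. {..m})"
    have "\<rho> ^ n * (\<Prod>i<n. w (f i)) = (\<Prod>i<n. \<rho> * w (f i))"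
      by (simp add: prod.distrib)
    also have "\<dots> \<le> (\<Prod>i<n. w' (f i))"
      using f \<rho> w w' by (intro prod_mono) (auto simp: PiE_iff)
    finally show "\<rho> ^ n * ((\<Prod>i<n. w (f i)) * indicator A (\<lambda>i\<in>{..<n}. real (f i)))
        \<le> (\<Prod>i<n. w' (f i)) * indicator A (\<lambda>i\<in>{..<n}. real (f i))"
      by (auto simp: indicator_def)
  qed
qed

text \<open>
  One plus the chi-square divergence is multiplicative over independent coordinates, which extends
  \<open>sum_le_sum_plus_chi_square\<close> to samples of size \<open>n\<close>.
\<close>

lemma measure_PiM_finite_law_chi_square:
  fixes n :: nat
  assumes w: "\<And>k. k \<le> m \<Longrightarrow> w k > 0" "(\<Sum>k\<le>m. w k) = 1"
    and w': "\<And>k. k \<le> m \<Longrightarrow> w' k \<ge> 0" "(\<Sum>k\<le>m. w' k) = 1"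
    and chi: "(\<Sum>k\<le>m. (w' k)\<^sup>2 / w k) ^ n \<le> 1 + \<eta>\<^sup>2" and "\<eta> \<ge> 0"
    and A: "A \<in> sets (PiM {..<n} (\<lambda>_. borel))"
  shows "measure (PiM {..<n} (\<lambda>_. finite_law m w)) A
       \<le> measure (PiM {..<n} (\<lambda>_. finite_law m w')) A + \<eta>"
proof -
  have w0: "\<And>k. k \<le> m \<Longrightarrow> w k \<ge> 0" using w(1) by (auto intro: less_imp_le)
  have "measure (PiM {..<n} (\<lambda>_. finite_law m u)) A
       = (\<Sum>f\<in>PiE {..<n} (\<lambda>_. {..m}). (\<Prod>i<n. u (f i)) * indicator A (\<lambda>i\<in>{..<n}. real (f i)))"
    if "u = w \<or> u = w'" for u
    using that w0 w w' A by (intro measure_PiM_finite_law) auto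
  note eq = this[of w, simplified] this[of w', simplified]
  show ?thesis
    unfolding eq
  proof (rule sum_le_sum_plus_chi_square)
    show "finite (PiE {..<n} (\<lambda>_. {..m}))" by (intro finite_PiE) auto
    show "(\<Sum>f\<in>PiE {..<n} (\<lambda>_. {..m}). \<Prod>i<n. w (f i)) = 1"
      "(\<Sum>f\<in>PiE {..<n} (\<lambda>_. {..m}). \<Prod>i<n. w' (f i)) = 1"
      using w(2) w'(2) prod_sum_PiE[of "{..<n}" "\<lambda>_. {..m}" "\<lambda>_ k. w k"]
        prod_sum_PiE[of "{..<n}" "\<lambda>_. {..m}" "\<lambda>_ k. w' k"] by simp_all
    have "(\<Sum>f\<in>PiE {..<n} (\<lambda>_. {..m}). (\<Prod>i<n. w' (f i))\<^sup>2 / (\<Prod>i<n. w (f i)))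
        = (\<Sum>f\<in>PiE {..<n} (\<lambda>_. {..m}). \<Prod>i<n. (w' (f i))\<^sup>2 / w (f i))"
      by (simp add: prod_dividef prod_power_distrib)
    also have "\<dots> = (\<Sum>k\<le>m. (w' k)\<^sup>2 / w k) ^ n"
      using prod_sum_PiE[of "{..<n}" "\<lambda>_. {..m}" "\<lambda>_ k. (w' k)\<^sup>2 / w k"] by simp
    finally show "(\<Sum>f\<in>PiE {..<n} (\<lambda>_. {..m}). (\<Prod>i<n. w' (f i))\<^sup>2 / (\<Prod>i<n. w (f i)))
        \<le> 1 + \<eta>\<^sup>2" using chi by simp
  qed (use w(1) \<open>\<eta> \<ge> 0\<close> in \<open>auto simp: PiE_iff indicator_def intro!: prod_pos\<close>)
qed

text \<open>
  Two laws at total variation distance at most \<open>\<epsilon>\<close> become equal after suitable contaminations of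
  proportion \<open>\<epsilon>\<close>.
\<close>

lemma exists_equalizing_contaminations:
  assumes w: "\<And>k. k \<le> m \<Longrightarrow> w k \<ge> 0" "(\<Sum>k\<le>m. w k) = 1"
    and w': "\<And>k. k \<le> m \<Longrightarrow> w' k \<ge> 0" "(\<Sum>k\<le>m. w' k) = 1"
    and \<epsilon>: "0 < \<epsilon>" "\<epsilon> \<le> 1"
    and \<Delta>: "(\<Sum>k\<le>m. max 0 (w k - w' k)) \<le> \<epsilon>"
  obtains v v' where "\<And>k. k \<le> m \<Longrightarrow> v k \<ge> 0" "(\<Sum>k\<le>m. v k) = 1"
    "\<And>k. k \<le> m \<Longrightarrow> v' k \<ge> 0" "(\<Sum>k\<le>m. v' k) = (1::real)"
    "\<And>k. (1 - \<epsilon>) * w k + \<epsilon> * v k = (1 - \<epsilon>) * w' k + \<epsilon> * v' k"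
proof -
  define D where "D = (\<Sum>k\<le>m. max 0 (w k - w' k))"
  have D: "0 \<le> D" "D \<le> \<epsilon>" using \<Delta> by (auto simp: D_def intro!: sum_nonneg)
  \<comment> \<open>The common mixture is the normalised pointwise maximum, which dominates both \<open>(1 -
    \<epsilon>) w\<close> and \<open>(1 - \<epsilon>) w'\<close>.\<close>
  define R where "R k = max (w k) (w' k) / (1 + D)" for k
  have "(\<Sum>k\<le>m. max (w k) (w' k)) = (\<Sum>k\<le>m. w' k + max 0 (w k - w' k))"
    by (intro sum.cong) auto
  also have "\<dots> = 1 + D" by (simp add: sum.distrib w' D_def)
  finally have R1: "(\<Sum>k\<le>m. R k) = 1" using D by (simp add: R_def flip: sum_divide_distrib)
  have "(1 - \<epsilon>) * (1 + D) = 1 + D - \<epsilon> - \<epsilon> * D" by (simp add: algebra_simps)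
  also have "\<dots> \<le> 1" using D \<epsilon> mult_nonneg_nonneg[of \<epsilon> D] by linarith
  finally have le: "(1 - \<epsilon>) * (1 + D) \<le> 1" .
  have RR: "(1 - \<epsilon>) * max (w k) (w' k) \<le> R k" if "k \<le> m" for k
  proof -
    have "(1 - \<epsilon>) * (1 + D) * max (w k) (w' k) \<le> 1 * max (w k) (w' k)"
      using le w(1)[OF that] by (intro mult_right_mono) auto
    then show ?thesis using D by (simp add: R_def pos_le_divide_eq mult_ac)
  qed
  have Rw: "(1 - \<epsilon>) * w k \<le> R k" "(1 - \<epsilon>) * w' k \<le> R k" if "k \<le> m" for k
    using RR[OF that] \<epsilon> mult_left_mono[of "w k" "max (w k) (w' k)" "1 - \<epsilon>"]
      mult_left_mono[of "w' k" "max (w k) (w' k)" "1 - \<epsilon>"] by auto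
  have s: "(\<Sum>k\<le>m. (R k - (1 - \<epsilon>) * u k) / \<epsilon>) = 1" if "(\<Sum>k\<le>m. u k) = 1" for u
    using that R1 \<epsilon> by (simp add: sum_subtractf flip: sum_divide_distrib sum_distrib_left)
  show ?thesis
    by (rule that[of "\<lambda>k. (R k - (1 - \<epsilon>) * w k) / \<epsilon>" "\<lambda>k. (R k - (1 - \<epsilon>) * w' k) / \<epsilon>"])
       (use Rw \<epsilon> s w w' in auto)
qed

section \<open>The two-point lower bound on the length\<close>

lemma sets_sample_distr [simp, measurable_cong]:
  "sets (sample_distr n m \<epsilon> p Q) = sets (PiM {..<n} (\<lambda>_. borel))"
  unfolding sample_distr_def by (intro sets_PiM_cong) auto

lemma interval_measurable_sets:
  assumes "CI \<in> intervals n"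
  shows "{x \<in> space (sample_distr n m \<epsilon> p Q). a \<in> interval_at CI x}
           \<in> sets (PiM {..<n} (\<lambda>_. borel))"
    and "{x \<in> space (sample_distr n m \<epsilon> p Q). r \<le> interval_len CI x}
           \<in> sets (PiM {..<n} (\<lambda>_. borel))"
    and "{x \<in> space (sample_distr n m \<epsilon> p Q). interval_len CI x \<le> r}
           \<in> sets (PiM {..<n} (\<lambda>_. borel))"
proof -
  obtain l u where CI: "CI = (l, u)" by fastforce
  have [measurable]: "l \<in> borel_measurable (PiM {..<n} (\<lambda>_. borel))"
      "u \<in> borel_measurable (PiM {..<n} (\<lambda>_. borel))"
    using assms by (auto simp: intervals_def CI)
  have sp: "space (sample_distr n m \<epsilon> p Q) = space (PiM {..<n} (\<lambda>_. borel))"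
    by (rule sets_eq_imp_space_eq) simp
  show "{x \<in> space (sample_distr n m \<epsilon> p Q). a \<in> interval_at CI x}
           \<in> sets (PiM {..<n} (\<lambda>_. borel))"
    "{x \<in> space (sample_distr n m \<epsilon> p Q). r \<le> interval_len CI x}
           \<in> sets (PiM {..<n} (\<lambda>_. borel))"
    "{x \<in> space (sample_distr n m \<epsilon> p Q). interval_len CI x \<le> r}
           \<in> sets (PiM {..<n} (\<lambda>_. borel))"
    unfolding sp interval_at_def interval_len_def CI atLeastAtMost_iff fst_conv snd_conv by measurable
qed

lemma Prob_bounds:
  assumes "real_distribution Q" "\<epsilon> \<in> {0..1}"
  shows "0 \<le> Prob n m \<epsilon> p Q E" "Prob n m \<epsilon> p Q E \<le> 1"
  using prob_space.prob_le_1[OF prob_space_sample_distr[OF assms]] by (auto simp: Prob_def)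

lemma ci_class_coverage:
  assumes "CI \<in> ci_class n m \<alpha> \<epsilon>" "\<epsilon> \<in> {0..1}" "p \<in> {0..1}" "real_distribution Q"
  shows "Prob n m \<epsilon> p Q (\<lambda>x. p \<in> interval_at CI x) \<ge> 1 - \<alpha>"
proof -
  have "(INF (p, Q) \<in> {0..1} \<times> distributions. Prob n m \<epsilon> p Q (\<lambda>x. p \<in> interval_at CI x))
      \<le> (case (p, Q) of (p, Q) \<Rightarrow> Prob n m \<epsilon> p Q (\<lambda>x. p \<in> interval_at CI x))"
    using assms by (intro cINF_lower) (auto intro!: bdd_belowI[of _ 0] Prob_bounds)
  then show ?thesis using assms(1) by (simp add: ci_class_def)
qed

lemma Prob_length_ge_two_point:
  assumes CI: "CI \<in> ci_class n m \<alpha> \<epsilon>" and \<epsilon>: "\<epsilon> \<in> {0..1}"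
    and p: "p \<in> {0..1}" "p' \<in> {0..1}" and Q: "real_distribution Q" "real_distribution Q'"
    and close: "\<And>A. A \<in> sets (PiM {..<n} (\<lambda>_. borel)) \<Longrightarrow>
        measure (sample_distr n m \<epsilon> p Q) A \<le> measure (sample_distr n m \<epsilon> p' Q') A + \<eta>"
    and r: "r \<le> \<bar>p - p'\<bar>"
  shows "Prob n m \<epsilon> p Q (\<lambda>x. interval_len CI x \<ge> r) \<ge> 1 - 2 * \<alpha> - \<eta>"
proof -
  let ?S = "sample_distr n m \<epsilon> p Q" and ?S' = "sample_distr n m \<epsilon> p' Q'"
  interpret S: prob_space ?S by (rule prob_space_sample_distr[OF Q(1) \<epsilon>])
  interpret S': prob_space ?S' by (rule prob_space_sample_distr[OF Q(2) \<epsilon>])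
  have sp: "space ?S' = space ?S" by (rule sets_eq_imp_space_eq) simp
  have "CI \<in> intervals n" using CI by (simp add: ci_class_def)
  note meas = interval_measurable_sets[OF this, of m \<epsilon> p Q]
  define A where "A a = {x \<in> space ?S. a \<in> interval_at CI x}" for a
  have A: "A a \<in> sets ?S" "A a \<in> sets ?S'" for a using meas(1) by (simp_all add: A_def)
  have "1 - \<alpha> \<le> measure ?S (A p)" "1 - \<alpha> \<le> measure ?S' (A p')"
    using ci_class_coverage[OF CI \<epsilon> p(1) Q(1)] ci_class_coverage[OF CI \<epsilon> p(2) Q(2)]
    by (simp_all add: Prob_def A_def sp)
  then have c: "measure ?S (space ?S - A p) \<le> \<alpha>" "measure ?S' (space ?S' - A p') \<le> \<alpha>"
    using A by (simp_all add: S.prob_compl S'.prob_compl)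
  have "measure ?S (space ?S - A p') \<le> \<alpha> + \<eta>"
  proof -
    have "space ?S - A p' \<in> sets ?S" using A by blast
    then have "measure ?S (space ?S - A p') \<le> measure ?S' (space ?S - A p') + \<eta>"
      by (intro close) simp
    then show ?thesis using c(2) by (simp add: sp)
  qed
  moreover have "measure ?S ((space ?S - A p) \<union> (space ?S - A p'))
      \<le> measure ?S (space ?S - A p) + measure ?S (space ?S - A p')"
    by (intro measure_Un_le sets.compl_sets A)
  moreover have "measure ?S ((space ?S - A p) \<union> (space ?S - A p')) = measure ?S (space ?S - (A p \<inter> A p'))"
    by (simp add: Diff_Int)
  moreover have "measure ?S (space ?S - (A p \<inter> A p')) = 1 - measure ?S (A p \<inter> A p')"
    using A by (intro S.prob_compl) auto
  ultimately have "1 - 2 * \<alpha> - \<eta> \<le> measure ?S (A p \<inter> A p')" using c(1) by linarith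
  also have "\<dots> \<le> measure ?S {x \<in> space ?S. interval_len CI x \<ge> r}"
    using meas(2) r
    by (intro S.finite_measure_mono) (auto simp: A_def interval_at_def interval_len_def)
  finally show ?thesis by (simp add: Prob_def)
qed

text \<open>
  The bound of the preceding lemma is the same for every interval of the class and strictly exceeds
  \<open>\<alpha>\<close>, so it survives the infimum over the class.
\<close>

lemma opt_length_ge_two_point:
  assumes \<alpha>: "0 < \<alpha>" "3 * \<alpha> + \<eta> < 1" and \<epsilon>: "\<epsilon> \<in> {0..1}"
    and p: "p \<in> {0..1}" "p' \<in> {0..1}" and Q: "real_distribution Q" "real_distribution Q'"
    and close: "\<And>A. A \<in> sets (PiM {..<n} (\<lambda>_. borel)) \<Longrightarrow>
        measure (sample_distr n m \<epsilon> p Q) A \<le> measure (sample_distr n m \<epsilon> p' Q') A + \<eta>"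
  shows "\<bar>p - p'\<bar> \<le> opt_length n m \<alpha> \<epsilon> p \<epsilon>"
  unfolding opt_length_def
proof (rule cInf_greatest)
  define s where "s CI r = (SUP Q \<in> distributions. Prob n m \<epsilon> p Q (\<lambda>x. interval_len CI x \<ge> r))"
    for CI r
  have bdd: "bdd_above ((\<lambda>Q. Prob n m \<epsilon> p Q (\<lambda>x. interval_len CI x \<ge> r)) ` distributions)" for CI r
    using Prob_bounds \<epsilon> by (auto intro!: bdd_aboveI[of _ 1])
  have le_s: "Prob n m \<epsilon> p Q (\<lambda>x. interval_len CI x \<ge> r) \<le> s CI r" if "real_distribution Q" for Q CI r
    unfolding s_def using that by (intro cSUP_upper bdd) auto
  \<comment> \<open>The trivial interval \<open>[0,1]\<close> shows that the set defining
    \<open>opt_length\<close> contains \<open>2\<close>, hence that its infimum is a genuine one.\<close>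
  let ?U = "((\<lambda>_. 0), (\<lambda>_. 1)) :: interval_fn"
  have U: "?U \<in> ci_class n m \<alpha> \<epsilon>" using \<alpha> \<epsilon> by (intro unit_interval_in_ci_class) auto
  have "(INF CI \<in> ci_class n m \<alpha> \<epsilon>. s CI 2) \<le> s ?U 2"
  proof (intro cINF_lower U bdd_belowI[of _ 0])
    fix y assume "y \<in> (\<lambda>CI. s CI 2) ` ci_class n m \<alpha> \<epsilon>"
    then obtain CI where "y = s CI 2" by auto
    then show "0 \<le> y" using le_s[OF Q(1), where CI=CI and r=2] Prob_bounds(1)[OF Q(1) \<epsilon>] by (metis order_trans)
  qed
  also have "s ?U 2 \<le> \<alpha>"
    unfolding s_def using \<alpha> distributions_nonempty
    by (intro cSUP_least) (auto simp: Prob_def interval_len_def)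
  finally show "{r. r \<ge> 0 \<and> (INF CI \<in> ci_class n m \<alpha> \<epsilon>. SUP Q \<in> distributions.
        Prob n m \<epsilon> p Q (\<lambda>x. interval_len CI x \<ge> r)) \<le> \<alpha>} \<noteq> {}"
    unfolding s_def[symmetric] by (intro exI[of _ 2] ex_in_conv[THEN iffD1]) auto
  fix r assume "r \<in> {r. r \<ge> 0 \<and> (INF CI \<in> ci_class n m \<alpha> \<epsilon>. SUP Q \<in> distributions.
        Prob n m \<epsilon> p Q (\<lambda>x. interval_len CI x \<ge> r)) \<le> \<alpha>}"
  then have r: "(INF CI \<in> ci_class n m \<alpha> \<epsilon>. s CI r) \<le> \<alpha>" by (simp add: s_def)
  show "\<bar>p - p'\<bar> \<le> r"
  proof (rule ccontr)
    assume "\<not> \<bar>p - p'\<bar> \<le> r"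
    then have "1 - 2 * \<alpha> - \<eta> \<le> s CI r" if "CI \<in> ci_class n m \<alpha> \<epsilon>" for CI
      using Prob_length_ge_two_point[OF that \<epsilon> p Q close, of r] le_s[OF Q(1), where CI=CI and r=r] by linarith
    then have "1 - 2 * \<alpha> - \<eta> \<le> (INF CI \<in> ci_class n m \<alpha> \<epsilon>. s CI r)"
      using U by (intro cINF_greatest) auto
    then show False using r \<alpha> by linarith
  qed
qed

section \<open>The four terms of the lower bound\<close>

text \<open>
  The parameter \<open>p\<close> moved by \<open>t\<close> towards \<open>1/2\<close>; the result is a probability for \<open>t \<le> 1/2\<close>. As the larger
  of \<open>p\<close> and \<open>1 - p\<close> is the one that decreases, both keep at least the fraction \<open>1 - 2t\<close> of their value.
\<close>

definition shift_to_half :: "real \<Rightarrow> real \<Rightarrow> real" where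
  "shift_to_half p t = (if p \<le> 1/2 then p + t else p - t)"

lemma shift_to_half:
  assumes "p \<in> {0..1}" "0 \<le> t" "t \<le> 1/2"
  shows "shift_to_half p t \<in> {0..1}" "\<bar>p - shift_to_half p t\<bar> = t"
    "(shift_to_half p t - p)\<^sup>2 = t\<^sup>2"
    "(1 - 2 * t) * p \<le> shift_to_half p t" "(1 - 2 * t) * (1 - p) \<le> 1 - shift_to_half p t"
proof -
  have "t \<le> 2 * (t * p)" if "1/2 < p" using that assms mult_left_mono[of "1/2" p t] by simp
  moreover have "2 * (t * p) \<le> t" if "p \<le> 1/2" using that assms mult_left_mono[of p "1/2" t] by simp
  moreover have "0 \<le> t * p" "t * p \<le> t" using assms by (auto simp: mult_left_le)
  ultimately show "(1 - 2 * t) * p \<le> shift_to_half p t"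
      "(1 - 2 * t) * (1 - p) \<le> 1 - shift_to_half p t"
    by (auto simp: shift_to_half_def algebra_simps)
qed (use assms in \<open>auto simp: shift_to_half_def\<close>)

lemma sample_distr_no_contamination:
  assumes "p \<in> {0..1}" "\<epsilon> \<in> {0..1}"
  shows "sample_distr n m \<epsilon> p (binomial_distr m p)
       = PiM {..<n} (\<lambda>_. finite_law m (\<lambda>k. Bernstein m k p))"
proof -
  have "contam m \<epsilon> p (binomial_distr m p) = finite_law m (\<lambda>k. Bernstein m k p)"
    using assms contam_finite_law[of p \<epsilon> m "\<lambda>k. Bernstein m k p"]
    by (simp add: binomial_distr_eq_finite_law Bernstein_nonneg left_diff_distrib)
  then show ?thesis by (simp add: sample_distr_def)
qed

lemma opt_length_ge_sampling_sd:
  assumes \<alpha>: "0 < \<alpha>" "\<alpha> < 1/4" and \<epsilon>: "\<epsilon> \<in> {0..1}" and p: "0 < p" "p < 1"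
    and nm: "n \<ge> 1" "m \<ge> 1"
  shows "opt_length n m \<alpha> \<epsilon> p \<epsilon> \<ge> sqrt (p * (1 - p) / m) / sqrt n / 16"
proof -
  define t where "t = sqrt (p * (1 - p) / m) / sqrt n / 16"
  have pq: "0 < p * (1 - p)" "p * (1 - p) \<le> 1"
    using p mult_le_one[of p "1 - p"] by auto
  have "sqrt (p * (1 - p) / m) / sqrt n \<le> 1 / 1"
    using pq nm by (intro frac_le) (auto simp: divide_le_eq_1)
  then have t: "0 \<le> t" "t \<le> 1/2" using pq by (auto simp: t_def)
  define p' where "p' = shift_to_half p t"
  have p': "p' \<in> {0..1}" "\<bar>p - p'\<bar> = t" "(p' - p)\<^sup>2 = t\<^sup>2"
    unfolding p'_def using shift_to_half[of p t] p t by auto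
  have "t\<^sup>2 = p * (1 - p) / m / n / 256"
    using pq by (simp add: t_def power_divide)
  then have chi: "1 + (p' - p)\<^sup>2 / (p * (1 - p)) = 1 + 1 / (256 * (real m * real n))"
    using pq p'(3) nm p by (simp add: field_simps)
  have "(1 + 1 / (256 * (real m * real n))) ^ (m * n) \<le> exp (1 / (256 * (real m * real n))) ^ (m * n)"
    by (intro power_mono exp_ge_add_one_self) auto
  also have "\<dots> = exp (1 / 256)" using nm by (simp flip: exp_of_nat_mult)
  also have "exp (1 / 256 :: real) \<le> 1 + (1/4)\<^sup>2"
    using exp_bound[of "1/256"] by (simp add: power2_eq_square)
  finally have chi': "((1 + (p' - p)\<^sup>2 / (p * (1 - p))) ^ m) ^ n \<le> 1 + (1/4)\<^sup>2"
    by (simp add: chi power_mult)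
  have "t = \<bar>p - p'\<bar>" using p' by simp
  also have "\<dots> \<le> opt_length n m \<alpha> \<epsilon> p \<epsilon>"
  proof (rule opt_length_ge_two_point[where \<eta>="1/4"])
    fix A :: "(nat \<Rightarrow> real) set" assume A: "A \<in> sets (PiM {..<n} (\<lambda>_. borel))"
    show "measure (sample_distr n m \<epsilon> p (binomial_distr m p)) A
      \<le> measure (sample_distr n m \<epsilon> p' (binomial_distr m p')) A + 1/4"
      using p p' \<epsilon> A chi'
      by (simp only: sample_distr_no_contamination atLeastAtMost_iff less_imp_le simp_thms)
         (intro measure_PiM_finite_law_chi_square,
          auto simp: Bernstein_pos Bernstein_nonneg sum_Bernstein_chi_square)
  qed (use \<alpha> \<epsilon> p p' real_distribution_binomial_distr in auto)
  finally show ?thesis by (simp add: t_def)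
qed

lemma opt_length_ge_sampling_atom:
  assumes \<alpha>: "0 < \<alpha>" "\<alpha> < 1/4" and \<epsilon>: "\<epsilon> \<in> {0..1}" and p: "p \<in> {0..1}"
    and nm: "n \<ge> 1" "m \<ge> 1"
  shows "opt_length n m \<alpha> \<epsilon> p \<epsilon> \<ge> 1 / m * (1 / n) / 16"
proof -
  define t where "t = 1 / real m * (1 / real n) / 16"
  have mn: "1 \<le> real m * real n" using nm by (metis mult_le_mono1 mult_1 of_nat_1 of_nat_le_iff of_nat_mult order_trans)
  have t: "0 \<le> t" "t \<le> 1/2" "16 * t * (real m * real n) = 1"
    using mn nm by (auto simp: t_def field_simps)
  define p' where "p' = shift_to_half p t"
  have p': "p' \<in> {0..1}" "\<bar>p - p'\<bar> = t"
    "(1 - 2 * t) * p \<le> p'" "(1 - 2 * t) * (1 - p) \<le> 1 - p'"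
    unfolding p'_def using shift_to_half[of p t] p t by auto
  have "1 + real (m * n) * (- (2 * t)) \<le> (1 + - (2 * t)) ^ (m * n)"
    using t by (intro Bernoulli_inequality) auto
  then have pow: "3/4 \<le> ((1 - 2 * t) ^ m) ^ n" using t(3) by (simp add: power_mult mult_ac)
  have "t = \<bar>p - p'\<bar>" using p' by simp
  also have "\<dots> \<le> opt_length n m \<alpha> \<epsilon> p \<epsilon>"
  proof (rule opt_length_ge_two_point[where \<eta>="1/4"])
    fix A :: "(nat \<Rightarrow> real) set" assume A: "A \<in> sets (PiM {..<n} (\<lambda>_. borel))"
    let ?P = "\<lambda>p. measure (sample_distr n m \<epsilon> p (binomial_distr m p)) A"
    interpret P: prob_space "sample_distr n m \<epsilon> p (binomial_distr m p)"
      by (intro prob_space_sample_distr real_distribution_binomial_distr \<epsilon>)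
    have "3/4 * ?P p \<le> ((1 - 2 * t) ^ m) ^ n * ?P p"
      using pow by (intro mult_right_mono) auto
    also have "\<dots> \<le> ?P p'"
      using p p' \<epsilon> A t
      by (simp only: sample_distr_no_contamination)
         (intro measure_PiM_finite_law_minorization Bernstein_minorization,
          auto simp: Bernstein_nonneg)
    finally show "?P p \<le> ?P p' + 1/4" using P.prob_le_1[of A] by linarith
  qed (use \<alpha> \<epsilon> p p' real_distribution_binomial_distr in auto)
  finally show ?thesis by (simp add: t_def)
qed

text \<open>
  If contaminations can hide the difference between \<open>p\<close> and \<open>p'\<close>, then no sample size helps.
\<close>

lemma opt_length_ge_indistinguishable:
  assumes \<alpha>: "0 < \<alpha>" "\<alpha> < 1/4" and \<epsilon>: "0 < \<epsilon>" "\<epsilon> \<le> 1"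
    and p: "p \<in> {0..1}" "p' \<in> {0..1}"
    and \<Delta>: "(\<Sum>k\<le>m. max 0 (Bernstein m k p - Bernstein m k p')) \<le> \<epsilon>"
  shows "\<bar>p - p'\<bar> \<le> opt_length n m \<alpha> \<epsilon> p \<epsilon>"
proof -
  have "\<exists>v v'. (\<forall>k\<le>m. v k \<ge> 0) \<and> (\<Sum>k\<le>m. v k) = 1 \<and>
    (\<forall>k\<le>m. v' k \<ge> 0) \<and> (\<Sum>k\<le>m. v' k) = (1::real) \<and>
    (\<forall>k. (1 - \<epsilon>) * Bernstein m k p + \<epsilon> * v k = (1 - \<epsilon>) * Bernstein m k p' + \<epsilon> * v' k)"
    by (rule exists_equalizing_contaminations[OF _ _ _ _ \<epsilon> \<Delta>]) (use p in \<open>auto simp: Bernstein_nonneg\<close>)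
  then obtain v v' where v: "\<And>k. k \<le> m \<Longrightarrow> v k \<ge> 0" "(\<Sum>k\<le>m. v k) = 1"
    "\<And>k. k \<le> m \<Longrightarrow> v' k \<ge> 0" "(\<Sum>k\<le>m. v' k) = (1::real)"
    "\<And>k. (1 - \<epsilon>) * Bernstein m k p + \<epsilon> * v k = (1 - \<epsilon>) * Bernstein m k p' + \<epsilon> * v' k"
    by auto
  have "contam m \<epsilon> p (finite_law m v) = contam m \<epsilon> p' (finite_law m v')"
    using v p \<epsilon> by (simp add: contam_finite_law)
  then have same: "sample_distr n m \<epsilon> p (finite_law m v) = sample_distr n m \<epsilon> p' (finite_law m v')"
    by (simp add: sample_distr_def)
  show ?thesis
    by (rule opt_length_ge_two_point[where \<eta>=0 and Q="finite_law m v" and Q'="finite_law m v'"])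
       (use \<alpha> \<epsilon> p v same in \<open>auto intro!: real_distribution_finite_law\<close>)
qed

lemma opt_length_ge_contamination_sd:
  assumes \<alpha>: "0 < \<alpha>" "\<alpha> < 1/4" and \<epsilon>: "0 < \<epsilon>" "\<epsilon> \<le> 1" and p: "0 < p" "p < 1" and m: "m \<ge> 1"
  shows "opt_length n m \<alpha> \<epsilon> p \<epsilon> \<ge> sqrt (p * (1 - p) / m) * \<epsilon> / 16"
proof -
  define t where "t = sqrt (p * (1 - p) / m) * \<epsilon> / 16"
  have pq: "0 < p * (1 - p)" "p * (1 - p) \<le> 1"
    using p mult_le_one[of p "1 - p"] by auto
  have "sqrt (p * (1 - p) / m) * \<epsilon> \<le> 1 * 1"
    using pq m \<epsilon> by (intro mult_mono) (auto simp: divide_le_eq_1)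
  then have "t \<le> 1/2" unfolding t_def by linarith
  moreover have "0 \<le> t" using pq \<epsilon> by (simp add: t_def)
  ultimately have t: "0 \<le> t" "t \<le> 1/2" by auto
  define p' where "p' = shift_to_half p t"
  have p': "p' \<in> {0..1}" "\<bar>p - p'\<bar> = t" "(p' - p)\<^sup>2 = t\<^sup>2"
    unfolding p'_def using shift_to_half[of p t] p t by auto
  have "t\<^sup>2 = p * (1 - p) / m * \<epsilon>\<^sup>2 / 256"
    using pq by (simp add: t_def power_divide power_mult_distrib)
  then have chi: "1 + (p' - p)\<^sup>2 / (p * (1 - p)) = 1 + (\<epsilon> / 16)\<^sup>2 / m"
    using pq p'(3) m p by (simp add: field_simps power2_eq_square)
  have "(1 + (\<epsilon> / 16)\<^sup>2 / m) ^ m \<le> exp ((\<epsilon> / 16)\<^sup>2 / m) ^ m"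
    by (intro power_mono exp_ge_add_one_self) auto
  also have "\<dots> = exp ((\<epsilon> / 16)\<^sup>2)" using m by (simp flip: exp_of_nat_mult)
  also have "\<dots> \<le> 1 + \<epsilon>\<^sup>2"
  proof -
    have le: "(\<epsilon> / 16)\<^sup>2 \<le> 1" using \<epsilon> by (intro power_le_one) auto
    then have "exp ((\<epsilon> / 16)\<^sup>2) \<le> 1 + (\<epsilon> / 16)\<^sup>2 + ((\<epsilon> / 16)\<^sup>2)\<^sup>2"
      by (intro exp_bound) auto
    also have "((\<epsilon> / 16)\<^sup>2)\<^sup>2 \<le> (\<epsilon> / 16)\<^sup>2 * 1"
      unfolding power2_eq_square[of "(\<epsilon> / 16)\<^sup>2"] using le by (intro mult_left_mono) auto
    finally have "exp ((\<epsilon> / 16)\<^sup>2) \<le> 1 + \<epsilon>\<^sup>2 / 128" by (simp add: power_divide)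
    then show ?thesis using zero_le_power2[of \<epsilon>] by linarith
  qed
  finally have chi': "(1 + (p' - p)\<^sup>2 / (p * (1 - p))) ^ m \<le> 1 + \<epsilon>\<^sup>2"
    by (simp add: chi)
  \<comment> \<open>The indicator of the set where the first law exceeds the second turns the difference of means
    into the total variation distance.\<close>
  let ?g = "\<lambda>k. if Bernstein m k p' < Bernstein m k p then 1 else (0::real)"
  have "(\<Sum>k\<le>m. Bernstein m k p * ?g k) \<le> (\<Sum>k\<le>m. Bernstein m k p' * ?g k) + \<epsilon>"
    by (rule sum_le_sum_plus_chi_square)
       (use p \<epsilon> chi' in \<open>auto simp: sum_Bernstein_chi_square Bernstein_pos\<close>)
  moreover have "(\<Sum>k\<le>m. max 0 (Bernstein m k p - Bernstein m k p'))
      = (\<Sum>k\<le>m. Bernstein m k p * ?g k - Bernstein m k p' * ?g k)"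
    by (intro sum.cong) auto
  ultimately have "(\<Sum>k\<le>m. max 0 (Bernstein m k p - Bernstein m k p')) \<le> \<epsilon>"
    by (simp add: sum_subtractf)
  then have "\<bar>p - p'\<bar> \<le> opt_length n m \<alpha> \<epsilon> p \<epsilon>"
    using \<alpha> \<epsilon> p p' by (intro opt_length_ge_indistinguishable) auto
  then show ?thesis using p' by (simp add: t_def)
qed

lemma opt_length_ge_contamination_atom:
  assumes \<alpha>: "0 < \<alpha>" "\<alpha> < 1/4" and \<epsilon>: "0 < \<epsilon>" "\<epsilon> \<le> 1" and p: "p \<in> {0..1}" and m: "m \<ge> 1"
  shows "opt_length n m \<alpha> \<epsilon> p \<epsilon> \<ge> 1 / m * \<epsilon> / 16"
proof -
  define t where "t = 1 / real m * \<epsilon> / 16"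
  have t: "0 \<le> t" "t \<le> 1/2" "16 * t * real m = \<epsilon>"
    using \<epsilon> m by (auto simp: t_def field_simps)
  define p' where "p' = shift_to_half p t"
  have p': "p' \<in> {0..1}" "\<bar>p - p'\<bar> = t"
    "(1 - 2 * t) * p \<le> p'" "(1 - 2 * t) * (1 - p) \<le> 1 - p'"
    unfolding p'_def using shift_to_half[of p t] p t by auto
  have "1 + real m * (- (2 * t)) \<le> (1 + - (2 * t)) ^ m"
    using t by (intro Bernoulli_inequality) auto
  then have pow: "1 - \<epsilon> \<le> (1 - 2 * t) ^ m" using t(3) \<epsilon> by (simp add: mult_ac)
  have pow1: "(1 - 2 * t) ^ m \<le> 1" using t by (intro power_le_one) auto
  have "(\<Sum>k\<le>m. max 0 (Bernstein m k p - Bernstein m k p'))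
      \<le> (\<Sum>k\<le>m. (1 - (1 - 2 * t) ^ m) * Bernstein m k p)"
  proof (rule sum_mono)
    fix k assume "k \<in> {..m}"
    then have "(1 - 2 * t) ^ m * Bernstein m k p \<le> Bernstein m k p'"
      using t p p' by (intro Bernstein_minorization) auto
    moreover have "0 \<le> (1 - (1 - 2 * t) ^ m) * Bernstein m k p"
      using pow1 p by (auto simp: Bernstein_nonneg)
    ultimately show "max 0 (Bernstein m k p - Bernstein m k p')
      \<le> (1 - (1 - 2 * t) ^ m) * Bernstein m k p" by (simp add: left_diff_distrib)
  qed
  also have "\<dots> = 1 - (1 - 2 * t) ^ m" by (simp flip: sum_distrib_left)
  also have "\<dots> \<le> \<epsilon>" using pow by simp
  finally have "\<bar>p - p'\<bar> \<le> opt_length n m \<alpha> \<epsilon> p \<epsilon>"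
    using \<alpha> \<epsilon> p p' by (intro opt_length_ge_indistinguishable) auto
  then show ?thesis using p' by (simp add: t_def)
qed

lemma opt_length_ge_rate:
  assumes \<alpha>: "0 < \<alpha>" "\<alpha> < 1/4" and nm: "n \<ge> 1" "m \<ge> 1" and \<epsilon>: "\<epsilon> \<in> {0..1}" and p: "p \<in> {0..1}"
  shows "opt_length n m \<alpha> \<epsilon> p \<epsilon> \<ge> 1 / 64 * rate n m \<epsilon> p"
proof -
  let ?O = "opt_length n m \<alpha> \<epsilon> p \<epsilon>"
  have atom: "1 / m * (1 / n) / 16 \<le> ?O"
    using opt_length_ge_sampling_atom[OF \<alpha> \<epsilon> p nm] .
  have "0 \<le> 1 / real m * (1 / real n) / 16" by simp
  then have O: "0 \<le> ?O" using atom by linarith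
  have "sqrt (p * (1 - p) / m) / sqrt n / 16 \<le> ?O"
  proof (cases "p = 0 \<or> p = 1")
    case False
    then show ?thesis using opt_length_ge_sampling_sd[OF \<alpha> \<epsilon> _ _ nm, of p] p by auto
  qed (use O in auto)
  moreover have "sqrt (p * (1 - p) / m) * \<epsilon> / 16 \<le> ?O"
  proof (cases "p = 0 \<or> p = 1 \<or> \<epsilon> = 0")
    case False
    then show ?thesis using opt_length_ge_contamination_sd[OF \<alpha> _ _ _ _ nm(2), of \<epsilon> p n] p \<epsilon> by auto
  qed (use O in auto)
  moreover have "1 / m * \<epsilon> / 16 \<le> ?O"
  proof (cases "\<epsilon> = 0")
    case False
    then show ?thesis using opt_length_ge_contamination_atom[OF \<alpha> _ _ p nm(2), of \<epsilon> n] \<epsilon> by auto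
  qed (use O in auto)
  ultimately show ?thesis using atom by (simp add: rate_def distrib_left)
qed

section \<open>Deviations of sums of bounded variables\<close>

lemma exp_le_quadratic:
  fixes y :: real
  assumes "\<bar>y\<bar> \<le> 1"
  shows "exp y \<le> 1 + y + y\<^sup>2"
proof (cases "0 \<le> y")
  case True
  then show ?thesis using assms by (intro exp_bound) auto
next
  case False
  define a where "a = - y"
  have a: "0 < a" using False by (simp add: a_def)
  have "exp y = 1 / exp a" by (simp add: a_def exp_minus field_simps)
  also have "\<dots> \<le> 1 / (1 + a)" using a exp_ge_add_one_self[of a] by (intro frac_le) auto
  also have "\<dots> \<le> 1 - a + a\<^sup>2"
  proof -
    have "(1 - a + a\<^sup>2) * (1 + a) = 1 + a ^ 3" by (simp add: algebra_simps power2_eq_square power3_eq_cube)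
    then show ?thesis using a by (simp add: pos_divide_le_eq)
  qed
  finally show ?thesis by (simp add: a_def)
qed

lemma (in prob_space) exp_moment_le:
  assumes [measurable]: "f \<in> borel_measurable M" and f: "\<And>x. x \<in> space M \<Longrightarrow> f x \<in> {0..1::real}"
    and y: "\<bar>y\<bar> \<le> 1"
  shows "(\<integral>x. exp (y * f x) \<partial>M) \<le> exp ((\<integral>x. f x \<partial>M) * (y + y\<^sup>2))"
proof -
  have int: "integrable M f" using f by (intro integrable_const_bound[of _ 1]) auto
  have "(\<integral>x. exp (y * f x) \<partial>M) \<le> (\<integral>x. 1 + f x * (y + y\<^sup>2) \<partial>M)"
  proof (rule integral_mono)
    show "integrable M (\<lambda>x. exp (y * f x))"
    proof (rule integrable_const_bound[of _ "exp 1"])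
      show "AE x in M. norm (exp (y * f x)) \<le> exp 1"
      proof (rule AE_I2)
        fix x assume "x \<in> space M"
        then have "\<bar>y * f x\<bar> \<le> 1 * 1" using f y unfolding abs_mult by (intro mult_mono) force+
        then show "norm (exp (y * f x)) \<le> exp 1" by simp
      qed
    qed simp
    fix x assume "x \<in> space M"
    then have fx: "0 \<le> f x" "f x \<le> 1" using f by auto
    have "\<bar>y * f x\<bar> \<le> 1 * 1" using fx y unfolding abs_mult by (intro mult_mono) auto
    then have "exp (y * f x) \<le> 1 + y * f x + (y * f x)\<^sup>2" by (intro exp_le_quadratic) auto
    also have "(y * f x)\<^sup>2 \<le> y\<^sup>2 * f x"
      using fx unfolding power_mult_distrib
      by (intro mult_left_mono) (auto simp: power2_eq_square mult_left_le)
    finally show "exp (y * f x) \<le> 1 + f x * (y + y\<^sup>2)" by (simp add: algebra_simps)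
  qed (use int in auto)
  also have "\<dots> = 1 + (\<integral>x. f x \<partial>M) * (y + y\<^sup>2)" using int by (simp add: prob_space)
  also have "\<dots> \<le> exp ((\<integral>x. f x \<partial>M) * (y + y\<^sup>2))" by (rule exp_ge_add_one_self)
  finally show ?thesis .
qed

text \<open>
  A one-sided Bernstein-type inequality for variables with values in \<open>[0,1]\<close>, in which the mean \<open>\<mu>\<close>
  plays the role of the variance. The sign \<open>\<sigma>\<close> selects the upper or the lower tail.
\<close>

lemma (in prob_space) bounded_sum_tail_one_sided:
  fixes f :: "'a \<Rightarrow> real" and n :: nat and \<mu> :: real
  assumes f_meas [measurable]: "f \<in> borel_measurable M"
    and f: "\<And>x. x \<in> space M \<Longrightarrow> f x \<in> {0..1}"
    and L: "0 < L" and \<sigma>: "\<bar>\<sigma>\<bar> = 1"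
  defines "\<mu> \<equiv> (\<integral>x. f x \<partial>M)"
  defines "N \<equiv> PiM {..<n} (\<lambda>_. M)"
  shows "measure N {x \<in> space N. \<sigma> * ((\<Sum>i<n. f (x i)) - n * \<mu>) \<ge> 2 * sqrt (n * \<mu> * L) + 2 * L}
      \<le> exp (- L)"
proof -
  interpret P: product_prob_space "\<lambda>_::nat. M" ..
  interpret N: prob_space N unfolding N_def by (intro prob_space_PiM) (rule prob_space_axioms)
  define a where "a = n * \<mu>"
  have \<mu>: "0 \<le> \<mu>" unfolding \<mu>_def using f by (intro integral_nonneg_AE AE_I2) auto
  then have a: "0 \<le> a" by (simp add: a_def)
  \<comment> \<open>The exponent \<open>l\<close> optimises Markov's inequality for the exponential moment,
    subject to \<open>l \<le> 1\<close>.\<close>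
  define l where "l = (if L \<le> a then sqrt (L / a) else 1)"
  have l: "0 < l" "l \<le> 1" using L by (auto simp: l_def)
  have opt: "a * l\<^sup>2 - l * (2 * sqrt (a * L) + 2 * L) \<le> - L"
  proof (cases "L \<le> a")
    case True
    then have "a * l\<^sup>2 = L" "l * sqrt (a * L) = L"
      using L by (auto simp: l_def simp flip: real_sqrt_mult)
    moreover have "l * (2 * sqrt (a * L) + 2 * L) = 2 * (l * sqrt (a * L)) + 2 * (l * L)"
      by (simp add: algebra_simps)
    moreover have "0 \<le> l * L" using l L by simp
    ultimately show ?thesis by linarith
  next
    case False
    moreover have "0 \<le> sqrt (a * L)" using L a by simp
    ultimately have "a - 2 * sqrt (a * L) \<le> L" by linarith
    then show ?thesis using False L by (simp add: l_def)
  qed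
  define Y where "Y x = (\<Prod>i<n. exp (l * \<sigma> * f (x i)))" for x
  have Yexp: "Y x = exp (l * \<sigma> * (\<Sum>i<n. f (x i)))" for x
    by (simp add: Y_def exp_sum sum_distrib_left)
  have int1: "integrable M (\<lambda>x. exp (l * \<sigma> * f x))"
  proof (rule integrable_const_bound[of _ "exp 1"])
    show "AE x in M. norm (exp (l * \<sigma> * f x)) \<le> exp 1"
    proof (rule AE_I2)
      fix x assume "x \<in> space M"
      then have "\<bar>l * \<sigma> * f x\<bar> \<le> 1 * 1 * 1"
        using f l \<sigma> unfolding abs_mult by (intro mult_mono) force+
      then show "norm (exp (l * \<sigma> * f x)) \<le> exp 1" by simp
    qed
  qed simp
  have intY: "integrable N Y"
    unfolding N_def Y_def by (intro P.product_integrable_prod int1) auto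
  have "(\<integral>x. Y x \<partial>N) = (\<Prod>i<n. \<integral>x. exp (l * \<sigma> * f x) \<partial>M)"
    unfolding N_def Y_def by (intro P.product_integral_prod int1) auto
  also have "\<dots> = (\<integral>x. exp (l * \<sigma> * f x) \<partial>M) ^ n" by simp
  also have "\<dots> \<le> exp (\<mu> * (l * \<sigma> + (l * \<sigma>)\<^sup>2)) ^ n"
    unfolding \<mu>_def using l \<sigma> f
    by (intro power_mono exp_moment_le) (auto simp: abs_mult)
  also have "\<dots> = exp (a * (l * \<sigma>) + a * l\<^sup>2)"
  proof -
    have "\<sigma>\<^sup>2 = 1" using \<sigma> by (metis one_power2 power2_abs)
    then show ?thesis by (simp add: a_def power_mult_distrib algebra_simps flip: exp_of_nat_mult)
  qed
  finally have EY: "(\<integral>x. Y x \<partial>N) \<le> exp (a * (l * \<sigma>) + a * l\<^sup>2)" .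
  define c where "c = exp (l * \<sigma> * a + l * (2 * sqrt (a * L) + 2 * L))"
  have "{x \<in> space N. \<sigma> * ((\<Sum>i<n. f (x i)) - n * \<mu>) \<ge> 2 * sqrt (n * \<mu> * L) + 2 * L}
      = {x \<in> space N. c \<le> Y x}"
  proof (intro Collect_cong conj_cong refl)
    fix x
    have "c \<le> Y x \<longleftrightarrow> l * (2 * sqrt (a * L) + 2 * L) \<le> l * (\<sigma> * ((\<Sum>i<n. f (x i)) - a))"
      by (simp add: c_def Yexp algebra_simps)
    also have "\<dots> \<longleftrightarrow> 2 * sqrt (a * L) + 2 * L \<le> \<sigma> * ((\<Sum>i<n. f (x i)) - a)"
      using l by simp
    finally show "(2 * sqrt (n * \<mu> * L) + 2 * L \<le> \<sigma> * ((\<Sum>i<n. f (x i)) - n * \<mu>)) = (c \<le> Y x)"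
      by (simp add: a_def)
  qed
  also have "measure N \<dots> \<le> (\<integral>x. Y x \<partial>N) / c"
  proof (rule integral_Markov_inequality_measure[where A="{}", OF intY])
    show "AE x in N. 0 \<le> Y x" by (simp add: Yexp)
  qed (simp_all add: c_def)
  also have "\<dots> \<le> exp (a * (l * \<sigma>) + a * l\<^sup>2) / c"
    using EY by (intro divide_right_mono) (auto simp: c_def)
  also have "\<dots> = exp (a * l\<^sup>2 - l * (2 * sqrt (a * L) + 2 * L))"
    by (simp add: c_def algebra_simps flip: exp_diff)
  also have "\<dots> \<le> exp (- L)" using opt by simp
  finally show ?thesis .
qed

text \<open>
  Passing to \<open>1 - f\<close> when \<open>\<mu> > 1/2\<close> replaces the mean by the smaller of \<open>\<mu>\<close> and \<open>1 - \<mu>\<close>.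
\<close>

lemma (in prob_space) bounded_sum_tail_two_sided:
  fixes f :: "'a \<Rightarrow> real" and n :: nat and \<mu> :: real
  assumes f_meas [measurable]: "f \<in> borel_measurable M"
    and f: "\<And>x. x \<in> space M \<Longrightarrow> f x \<in> {0..1}"
    and L: "0 < L"
  defines "\<mu> \<equiv> (\<integral>x. f x \<partial>M)"
  defines "N \<equiv> PiM {..<n} (\<lambda>_. M)"
  shows "measure N {x \<in> space N. \<bar>(\<Sum>i<n. f (x i)) - n * \<mu>\<bar>
      \<ge> 2 * sqrt (n * min \<mu> (1 - \<mu>) * L) + 2 * L} \<le> 2 * exp (- L)"
proof -
  have *: "measure N {x \<in> space N. \<bar>(\<Sum>i<n. g (x i)) - n * \<nu>\<bar> \<ge> 2 * sqrt (n * \<nu> * L) + 2 * L}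
     \<le> 2 * exp (- L)"
    if [measurable]: "g \<in> borel_measurable M" and g: "\<And>x. x \<in> space M \<Longrightarrow> g x \<in> {0..1}"
      and \<nu>: "\<nu> = (\<integral>x. g x \<partial>M)" for g and \<nu> :: real
  proof -
    define B where "B \<sigma> = {x \<in> space N. \<sigma> * ((\<Sum>i<n. g (x i)) - n * \<nu>) \<ge> 2 * sqrt (n * \<nu> * L) + 2 * L}"
      for \<sigma> :: real
    have m: "B \<sigma> \<in> sets N" for \<sigma> unfolding B_def N_def by measurable
    have b: "measure N (B \<sigma>) \<le> exp (- L)" if "\<bar>\<sigma>\<bar> = 1" for \<sigma>
      unfolding B_def N_def \<nu> using that g L by (intro bounded_sum_tail_one_sided) auto
    have "{x \<in> space N. \<bar>(\<Sum>i<n. g (x i)) - n * \<nu>\<bar> \<ge> 2 * sqrt (n * \<nu> * L) + 2 * L} = B 1 \<union> B (-1)"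
      by (auto simp: B_def abs_if)
    also have "measure N \<dots> \<le> measure N (B 1) + measure N (B (-1))"
      by (intro measure_Un_le m)
    also have "\<dots> \<le> 2 * exp (- L)" using b[of 1] b[of "-1"] by simp
    finally show ?thesis .
  qed
  have int: "integrable M f" using f by (intro integrable_const_bound[of _ 1]) auto
  show ?thesis
  proof (cases "\<mu> \<le> 1 - \<mu>")
    case True
    then show ?thesis using *[of f \<mu>] f by (simp add: \<mu>_def min_def)
  next
    case False
    have "1 - \<mu> = (\<integral>x. 1 - f x \<partial>M)" using int by (simp add: \<mu>_def prob_space)
    then have "measure N {x \<in> space N. \<bar>(\<Sum>i<n. 1 - f (x i)) - n * (1 - \<mu>)\<bar>
        \<ge> 2 * sqrt (n * (1 - \<mu>) * L) + 2 * L} \<le> 2 * exp (- L)"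
      using f by (intro *[of "\<lambda>x. 1 - f x"]) auto
    moreover have "\<bar>(\<Sum>i<n. 1 - f (x i)) - n * (1 - \<mu>)\<bar> = \<bar>(\<Sum>i<n. f (x i)) - n * \<mu>\<bar>" for x
      by (simp add: sum_subtractf right_diff_distrib abs_minus_commute)
    moreover have "min \<mu> (1 - \<mu>) = 1 - \<mu>" using False by simp
    ultimately show ?thesis by simp
  qed
qed

section \<open>Statistics of the observed counts\<close>

text \<open>
  Contaminated observations are arbitrary reals; rounding down and truncating maps them to \<open>{..m}\<close>
  and leaves every value of the binomial law unchanged.
\<close>

definition bin_index :: "nat \<Rightarrow> real \<Rightarrow> nat" where
  "bin_index m x = min m (nat \<lfloor>x\<rfloor>)"

lemma bin_index_le [simp]: "bin_index m x \<le> m"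
  by (simp add: bin_index_def)

lemma bin_index_real [simp]: "k \<le> m \<Longrightarrow> bin_index m (real k) = k"
  by (simp add: bin_index_def)

lemma measurable_bin_index [measurable]: "bin_index m \<in> borel \<rightarrow>\<^sub>M count_space UNIV"
  unfolding bin_index_def by measurable

text \<open>
  The mean of \<open>g\<close> under the binomial law, written with Bernstein polynomials so that it is defined,
  and a polynomial in \<open>p\<close>, for every real \<open>p\<close>.
\<close>

definition binomial_mean :: "nat \<Rightarrow> real \<Rightarrow> (nat \<Rightarrow> real) \<Rightarrow> real" where
  "binomial_mean m p g = (\<Sum>k\<le>m. Bernstein m k p * g k)"

lemma binomial_mean_bounds:
  assumes "p \<in> {0..1}" "\<And>k. g k \<in> {0..1::real}"
  shows "0 \<le> binomial_mean m p g" "binomial_mean m p g \<le> 1"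
proof -
  show "0 \<le> binomial_mean m p g" unfolding binomial_mean_def
    using assms by (intro sum_nonneg mult_nonneg_nonneg) (auto simp: Bernstein_nonneg)
  have "binomial_mean m p g \<le> (\<Sum>k\<le>m. Bernstein m k p * 1)"
    unfolding binomial_mean_def using assms by (intro sum_mono mult_left_mono) (auto simp: Bernstein_nonneg)
  then show "binomial_mean m p g \<le> 1" by simp
qed

lemma integral_contam_bin_index:
  assumes Q: "real_distribution Q" and e: "\<epsilon> \<in> {0..1}" and p: "p \<in> {0..1}"
    and g: "\<And>k. g k \<in> {0..1::real}"
  shows "\<bar>(\<integral>x. g (bin_index m x) \<partial>contam m \<epsilon> p Q) - binomial_mean m p g\<bar> \<le> \<epsilon>"
proof -
  interpret Q: real_distribution Q by fact
  interpret B: real_distribution "binomial_distr m p" by (rule real_distribution_binomial_distr)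
  interpret C: real_distribution "contam m \<epsilon> p Q" by (rule real_distribution_contam[OF Q e])
  let ?A = "\<lambda>k. {x. bin_index m x = k}"
  have A: "?A k \<in> sets borel" for k
    using measurable_sets_borel[OF measurable_bin_index, of "{k}"]
    by (simp add: vimage_def)
  have Bk: "measure (binomial_distr m p) (?A k) = Bernstein m k p" if k: "k \<le> m" for k
  proof -
    have "emeasure (binomial_distr m p) (?A k) = ennreal (\<Sum>j\<le>m. Bernstein m j p * indicator (?A k) (real j))"
      unfolding binomial_distr_eq_finite_law[OF p]
      by (rule emeasure_finite_law) (use p A in \<open>auto simp: Bernstein_nonneg\<close>)
    also have "(\<Sum>j\<le>m. Bernstein m j p * indicator (?A k) (real j)) = (\<Sum>j\<le>m. if j = k then Bernstein m j p else 0)"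
      by (intro sum.cong) (auto simp: indicator_def)
    also have "\<dots> = Bernstein m k p" using k by simp
    finally show ?thesis using p by (simp add: measure_def Bernstein_nonneg)
  qed
  have Ck: "measure (contam m \<epsilon> p Q) (?A k) = (1 - \<epsilon>) * Bernstein m k p + \<epsilon> * measure Q (?A k)"
    if k: "k \<le> m" for k
  proof -
    have "emeasure (contam m \<epsilon> p Q) (?A k)
        = ennreal (1 - \<epsilon>) * ennreal (Bernstein m k p) + ennreal \<epsilon> * ennreal (measure Q (?A k))"
      by (simp add: emeasure_contam[OF Q A] B.emeasure_eq_measure Q.emeasure_eq_measure Bk[OF k])
    also have "\<dots> = ennreal ((1 - \<epsilon>) * Bernstein m k p + \<epsilon> * measure Q (?A k))"
      using e p by (subst ennreal_plus) (auto simp: ennreal_mult' Bernstein_nonneg)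
    finally have *: "emeasure (contam m \<epsilon> p Q) (?A k)
        = ennreal ((1 - \<epsilon>) * Bernstein m k p + \<epsilon> * measure Q (?A k))" .
    have "0 \<le> (1 - \<epsilon>) * Bernstein m k p + \<epsilon> * measure Q (?A k)"
      using e p by (simp add: Bernstein_nonneg)
    then show ?thesis unfolding measure_def[of "contam m \<epsilon> p Q"] * by simp
  qed
  have split: "g (bin_index m x) = (\<Sum>k\<le>m. g k * indicator (?A k) x)" for x
    by (simp add: indicator_def if_distrib cong: if_cong)
  have "(\<integral>x. g (bin_index m x) \<partial>contam m \<epsilon> p Q)
      = (\<Sum>k\<le>m. g k * measure (contam m \<epsilon> p Q) (?A k))"
    unfolding split using A by (subst Bochner_Integration.integral_sum) (auto simp: C.emeasure_eq_measure)
  also have "\<dots> = (\<Sum>k\<le>m. g k * ((1 - \<epsilon>) * Bernstein m k p + \<epsilon> * measure Q (?A k)))"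
    by (intro sum.cong) (auto simp: Ck)
  also have "\<dots> = (1 - \<epsilon>) * binomial_mean m p g + \<epsilon> * (\<Sum>k\<le>m. g k * measure Q (?A k))"
    by (simp add: binomial_mean_def sum_distrib_left algebra_simps sum.distrib sum_subtractf)
  finally have eq: "(\<integral>x. g (bin_index m x) \<partial>contam m \<epsilon> p Q) - binomial_mean m p g
      = \<epsilon> * ((\<Sum>k\<le>m. g k * measure Q (?A k)) - binomial_mean m p g)"
    by (simp add: algebra_simps)
  note bm = binomial_mean_bounds[of p g m, OF p g]
  have "(\<Sum>k\<le>m. measure Q (?A k)) = measure Q (\<Union>k\<le>m. ?A k)"
    using A by (intro Q.finite_measure_finite_Union[symmetric]) (auto simp: disjoint_family_on_def)
  then have "(\<Sum>k\<le>m. measure Q (?A k)) \<le> 1" by simp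
  moreover have "(\<Sum>k\<le>m. g k * measure Q (?A k)) \<le> (\<Sum>k\<le>m. 1 * measure Q (?A k))"
    using g by (intro sum_mono mult_right_mono) auto
  moreover have "0 \<le> (\<Sum>k\<le>m. g k * measure Q (?A k))" using g by (intro sum_nonneg) auto
  ultimately have "\<bar>(\<Sum>k\<le>m. g k * measure Q (?A k)) - binomial_mean m p g\<bar> \<le> 1"
    using bm by (simp add: abs_le_iff)
  then show ?thesis unfolding eq abs_mult using e mult_left_mono[of _ 1 \<epsilon>] by auto
qed

text \<open>
  The empirical mean of a statistic of the rounded observations.
\<close>

definition empirical_mean :: "nat \<Rightarrow> nat \<Rightarrow> (nat \<Rightarrow> real) \<Rightarrow> (nat \<Rightarrow> real) \<Rightarrow> real" where
  "empirical_mean n m g x = (\<Sum>i<n. g (bin_index m (x i))) / n"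

text \<open>
  The deviation of an empirical mean that is tolerated when the uncontaminated mean is \<open>\<mu>\<close>: a part due
  to contamination and a part due to sampling at confidence level \<open>1 - 2 exp (-L)\<close>.
\<close>

definition radius :: "nat \<Rightarrow> real \<Rightarrow> real \<Rightarrow> real \<Rightarrow> real" where
  "radius n \<epsilon> L \<mu> = 2 * \<epsilon> + 2 * sqrt (min \<mu> (1 - \<mu>) * L / n) + 3 * L / n"

lemma empirical_mean_measurable [measurable]:
  "empirical_mean n m g \<in> borel_measurable (PiM {..<n} (\<lambda>_. borel))"
  unfolding empirical_mean_def[abs_def] by measurable

lemma empirical_mean_concentration:
  assumes Q: "real_distribution Q" and e: "\<epsilon> \<in> {0..1}" and p: "p \<in> {0..1}"
    and g: "\<And>k. g k \<in> {0..1::real}" and L: "0 < L" and n: "n \<ge> 1"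
  shows "measure (sample_distr n m \<epsilon> p Q) {x \<in> space (sample_distr n m \<epsilon> p Q).
      \<not> \<bar>empirical_mean n m g x - binomial_mean m p g\<bar> \<le> radius n \<epsilon> L (binomial_mean m p g)}
      \<le> 2 * exp (- L)"
proof -
  let ?N = "sample_distr n m \<epsilon> p Q"
  interpret C: real_distribution "contam m \<epsilon> p Q" by (rule real_distribution_contam[OF Q e])
  interpret N: prob_space ?N by (rule prob_space_sample_distr[OF Q e])
  define f where "f x = g (bin_index m x)" for x
  have fm [measurable]: "f \<in> borel_measurable (contam m \<epsilon> p Q)"
    unfolding f_def[abs_def] by measurable
  define \<nu> where "\<nu> = (\<integral>x. f x \<partial>contam m \<epsilon> p Q)"
  define \<mu> where "\<mu> = binomial_mean m p g"
  have \<nu>\<mu>: "\<bar>\<nu> - \<mu>\<bar> \<le> \<epsilon>" unfolding \<nu>_def \<mu>_def f_def by (rule integral_contam_bin_index[OF Q e p g])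
  have \<mu>: "0 \<le> \<mu>" "\<mu> \<le> 1" unfolding \<mu>_def using binomial_mean_bounds[of p g m, OF p g] by auto
  define v where "v = min \<mu> (1 - \<mu>)"
  have v: "0 \<le> v" using \<mu> by (simp add: v_def)
  have vv: "min \<nu> (1 - \<nu>) \<le> v + \<epsilon>" using \<nu>\<mu> by (auto simp: v_def min_def)
  have e0: "0 \<le> \<epsilon>" using e by simp
  \<comment> \<open>The variance proxy of the contaminated law exceeds that of the binomial law by at most
    \<open>\<epsilon>\<close>; the excess is absorbed into the terms \<open>\<epsilon>\<close> and
    \<open>L / n\<close>.\<close>
  have sub: "2 * sqrt (min \<nu> (1 - \<nu>) * L / n) \<le> 2 * sqrt (v * L / n) + \<epsilon> + L / n"
  proof -
    have "sqrt (min \<nu> (1 - \<nu>) * L / n) \<le> sqrt (v * L / n + \<epsilon> * L / n)"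
      using vv L by (simp add: divide_right_mono flip: distrib_right add_divide_distrib)
    also have "\<dots> \<le> sqrt (v * L / n) + sqrt (\<epsilon> * (L / n))"
      using v L e0 by (simp add: sqrt_add_le_add_sqrt)
    finally have "sqrt (min \<nu> (1 - \<nu>) * L / n) \<le> sqrt (v * L / n) + sqrt (\<epsilon> * (L / n))" .
    moreover have "sqrt (\<epsilon> * (L / n)) \<le> (\<epsilon> + L / n) / 2"
      using L e0 by (intro arith_geo_mean_sqrt) auto
    moreover have "2 * A \<le> 2 * B + a + b" if "A \<le> B + C" "C \<le> (a + b) / 2" for A B C a b :: real
      using that by (simp add: field_simps)
    ultimately show ?thesis by blast
  qed
  have "measure ?N {x \<in> space ?N. \<not> \<bar>empirical_mean n m g x - \<mu>\<bar> \<le> radius n \<epsilon> L \<mu>}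
     \<le> measure ?N {x \<in> space ?N. \<bar>(\<Sum>i<n. f (x i)) - n * \<nu>\<bar> \<ge> 2 * sqrt (n * min \<nu> (1 - \<nu>) * L) + 2 * L}"
  proof (intro N.finite_measure_mono)
    show "{x \<in> space ?N. \<bar>(\<Sum>i<n. f (x i)) - n * \<nu>\<bar> \<ge> 2 * sqrt (n * min \<nu> (1 - \<nu>) * L) + 2 * L} \<in> sets ?N"
      unfolding sample_distr_def by measurable
    show "{x \<in> space ?N. \<not> \<bar>empirical_mean n m g x - \<mu>\<bar> \<le> radius n \<epsilon> L \<mu>}
      \<subseteq> {x \<in> space ?N. \<bar>(\<Sum>i<n. f (x i)) - n * \<nu>\<bar> \<ge> 2 * sqrt (n * min \<nu> (1 - \<nu>) * L) + 2 * L}"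
    proof (intro subsetI CollectI conjI; elim CollectE conjE)
      fix x assume x: "\<not> \<bar>empirical_mean n m g x - \<mu>\<bar> \<le> radius n \<epsilon> L \<mu>"
      have em: "empirical_mean n m g x = (\<Sum>i<n. f (x i)) / n" by (simp add: empirical_mean_def f_def)
      have "radius n \<epsilon> L \<mu> \<le> \<bar>(\<Sum>i<n. f (x i)) / n - \<nu>\<bar> + \<epsilon>"
        using x \<nu>\<mu> unfolding em by linarith
      then have "2 * sqrt (min \<nu> (1 - \<nu>) * L / n) + 2 * (L / n) \<le> \<bar>(\<Sum>i<n. f (x i)) / n - \<nu>\<bar>"
        using sub by (simp add: radius_def v_def)
      then have "n * (2 * sqrt (min \<nu> (1 - \<nu>) * L / n) + 2 * (L / n)) \<le> n * \<bar>(\<Sum>i<n. f (x i)) / n - \<nu>\<bar>"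
        by (intro mult_left_mono) auto
      also have "n * \<bar>(\<Sum>i<n. f (x i)) / n - \<nu>\<bar> = \<bar>(\<Sum>i<n. f (x i)) - n * \<nu>\<bar>"
      proof -
        have "n * ((\<Sum>i<n. f (x i)) / n - \<nu>) = (\<Sum>i<n. f (x i)) - n * \<nu>"
          using n by (simp add: right_diff_distrib)
        then show ?thesis by (metis abs_mult abs_of_nat)
      qed
      also have "n * (2 * sqrt (min \<nu> (1 - \<nu>) * L / n) + 2 * (L / n))
          = 2 * (n * sqrt (min \<nu> (1 - \<nu>) * L / n)) + 2 * L"
        using n by (simp add: field_simps)
      also have "n * sqrt (min \<nu> (1 - \<nu>) * L / n) = sqrt ((real n)\<^sup>2 * (min \<nu> (1 - \<nu>) * L / n))"
        by (simp only: real_sqrt_mult real_sqrt_abs abs_of_nat)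
      also have "(real n)\<^sup>2 * (min \<nu> (1 - \<nu>) * L / n) = n * min \<nu> (1 - \<nu>) * L"
        using n by (simp add: power2_eq_square)
      finally show "\<bar>(\<Sum>i<n. f (x i)) - n * \<nu>\<bar> \<ge> 2 * sqrt (n * min \<nu> (1 - \<nu>) * L) + 2 * L" .
    qed
  qed
  also have "\<dots> \<le> 2 * exp (- L)"
    unfolding sample_distr_def \<nu>_def using g L
    by (intro C.bounded_sum_tail_two_sided) (auto simp: f_def)
  finally show ?thesis by (simp add: \<mu>_def)
qed

section \<open>Binomial means as functions of the success probability\<close>

lemma Bernstein_Suc_Suc:
  "Bernstein (Suc m) (Suc k) p = p * Bernstein m k p + (1 - p) * Bernstein m (Suc k) p"
proof (cases "k < m")
  case True
  then have "m - k = Suc (m - Suc k)" by simp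
  then show ?thesis by (simp add: Bernstein_def algebra_simps)
next
  case False
  then show ?thesis by (simp add: Bernstein_def binomial_eq_0)
qed

lemma binomial_mean_Suc:
  "binomial_mean (Suc m) p g = (1 - p) * binomial_mean m p g + p * binomial_mean m p (\<lambda>k. g (Suc k))"
proof -
  have "binomial_mean (Suc m) p g
      = Bernstein (Suc m) 0 p * g 0 + (\<Sum>k\<le>m. Bernstein (Suc m) (Suc k) p * g (Suc k))"
    unfolding binomial_mean_def by (rule sum.atMost_Suc_shift)
  also have "\<dots> = p * binomial_mean m p (\<lambda>k. g (Suc k))
      + (1 - p) * (Bernstein m 0 p * g 0 + (\<Sum>k\<le>m. Bernstein m (Suc k) p * g (Suc k)))"
  proof -
    have "(\<Sum>k\<le>m. Bernstein (Suc m) (Suc k) p * g (Suc k))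
        = (\<Sum>k\<le>m. p * (Bernstein m k p * g (Suc k)) + (1 - p) * (Bernstein m (Suc k) p * g (Suc k)))"
      by (intro sum.cong) (auto simp: Bernstein_Suc_Suc algebra_simps)
    also have "\<dots> = p * binomial_mean m p (\<lambda>k. g (Suc k))
        + (1 - p) * (\<Sum>k\<le>m. Bernstein m (Suc k) p * g (Suc k))"
      by (simp only: binomial_mean_def sum.distrib sum_distrib_left)
    moreover have "Bernstein (Suc m) 0 p = (1 - p) * Bernstein m 0 p"
      by (simp add: Bernstein_def)
    ultimately show ?thesis by (simp add: distrib_left)
  qed
  also have "Bernstein m 0 p * g 0 + (\<Sum>k\<le>m. Bernstein m (Suc k) p * g (Suc k))
      = (\<Sum>k\<le>Suc m. Bernstein m k p * g k)"
    by (rule sum.atMost_Suc_shift[symmetric])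
  also have "\<dots> = binomial_mean m p g"
    by (simp add: binomial_mean_def Bernstein_def)
  finally show ?thesis by simp
qed

lemma binomial_mean_0 [simp]: "binomial_mean 0 p g = g 0"
  by (simp add: binomial_mean_def Bernstein_def)

lemma binomial_mean_diff:
  "binomial_mean m p (\<lambda>k. f k - g k) = binomial_mean m p f - binomial_mean m p g"
  by (simp add: binomial_mean_def right_diff_distrib sum_subtractf)

lemma binomial_mean_mono:
  assumes "p \<in> {0..1}" "\<And>k. k \<le> m \<Longrightarrow> f k \<le> g k"
  shows "binomial_mean m p f \<le> binomial_mean m p g"
  unfolding binomial_mean_def using assms
  by (intro sum_mono mult_left_mono) (auto simp: Bernstein_nonneg)

lemma binomial_mean_cmult: "binomial_mean m p (\<lambda>k. c * g k) = c * binomial_mean m p g"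
  by (simp add: binomial_mean_def sum_distrib_left mult_ac)

lemma binomial_mean_add:
  "binomial_mean m p (\<lambda>k. f k + g k) = binomial_mean m p f + binomial_mean m p g"
  by (simp add: binomial_mean_def distrib_left sum.distrib)

lemma binomial_mean_const [simp]: "binomial_mean m p (\<lambda>_. c) = c"
  by (simp add: binomial_mean_def flip: sum_distrib_right)

text \<open>
  The derivative of a binomial mean is a mean of increments under the binomial law with one trial
  fewer. It is proved by induction through the recursion \<open>binomial_mean_Suc\<close>.
\<close>

lemma binomial_mean_has_derivative:
  "((\<lambda>p. binomial_mean (Suc m) p g) has_real_derivative
     real (Suc m) * binomial_mean m p (\<lambda>k. g (Suc k) - g k)) (at p)"
proof (induction m arbitrary: g)
  case 0
  show ?case
    unfolding binomial_mean_Suc by (auto intro!: derivative_eq_intros)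
next
  case (Suc m)
  let ?D = "\<lambda>g k. g (Suc k) - g k :: real"
  have "((\<lambda>p. binomial_mean (Suc (Suc m)) p g) has_real_derivative
     - binomial_mean (Suc m) p g + (1 - p) * (real (Suc m) * binomial_mean m p (?D g))
     + (binomial_mean (Suc m) p (\<lambda>k. g (Suc k))
        + p * (real (Suc m) * binomial_mean m p (?D (\<lambda>k. g (Suc k)))))) (at p)"
    unfolding binomial_mean_Suc[of "Suc m"]
    by (rule derivative_eq_intros Suc.IH refl | simp)+
  moreover have "- binomial_mean (Suc m) p g + (1 - p) * (real (Suc m) * binomial_mean m p (?D g))
     + (binomial_mean (Suc m) p (\<lambda>k. g (Suc k))
        + p * (real (Suc m) * binomial_mean m p (?D (\<lambda>k. g (Suc k)))))
     = binomial_mean (Suc m) p (?D g) + real (Suc m) * binomial_mean (Suc m) p (?D g)"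
    unfolding binomial_mean_Suc[of m p "?D g"]
    by (subst binomial_mean_Suc[of m p "?D g", symmetric], subst binomial_mean_diff)
       (simp add: algebra_simps)
  ultimately show ?case by (simp add: algebra_simps)
qed

section \<open>The variance-stabilising angle\<close>

lemma half_le_sin:
  assumes "0 \<le> x" "x \<le> pi / 2"
  shows "x / 2 \<le> sin x"
proof (cases "x = 0")
  case False
  define y where "y = x / 2"
  have y: "0 < y" "y \<le> pi / 2" "x = 2 * y" using assms False by (auto simp: y_def)
  \<comment> \<open>With \<open>y = x/2\<close>: \<open>sin x = 2 sin y cos y\<close> and \<open>sin y \<ge> y cos
    y\<close>.\<close>
  obtain z where z: "0 < z" "z < y" "sin y - sin 0 = (y - 0) * cos z"
    using MVT2[of 0 y sin cos] y(1) by (auto intro!: derivative_eq_intros)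
  have "cos y \<le> cos z" using z y by (intro cos_monotone_0_pi_le) auto
  then have "y * cos y \<le> sin y" using z(3) y by simp
  moreover have cy: "0 \<le> cos y" using y by (intro cos_ge_zero) auto
  ultimately have "2 * (y * cos y * cos y) \<le> 2 * (sin y * cos y)"
    by (intro mult_left_mono mult_right_mono) auto
  also have "\<dots> = sin x" by (simp add: y(3) sin_double)
  also have "2 * (y * cos y * cos y) = y * (1 + cos x)"
    by (simp add: y(3) cos_double_cos power2_eq_square)
  finally have "y * (1 + cos x) \<le> sin x" .
  moreover have "0 \<le> cos x" using assms by (intro cos_ge_zero) auto
  then have "y * 1 \<le> y * (1 + cos x)" using y by (intro mult_left_mono) auto
  ultimately show ?thesis by (simp add: y_def)
qed simp

lemma abs_sin_diff_le: "\<bar>sin x - sin y\<bar> \<le> \<bar>x - y\<bar>" for x y :: real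
proof -
  have "\<bar>sin x - sin y\<bar> = 2 * \<bar>sin ((x - y) / 2)\<bar> * \<bar>cos ((x + y) / 2)\<bar>"
    by (simp add: sin_diff_sin abs_mult)
  also have "\<dots> \<le> 2 * \<bar>(x - y) / 2\<bar> * 1"
    by (intro mult_mono abs_sin_x_le_abs_x) auto
  finally show ?thesis by simp
qed

text \<open>
  The coordinate \<open>\<theta> = arcsin \<surd>p\<close>, in which the standard deviation of a binomial proportion does not
  depend on \<open>p\<close> up to constants.
\<close>

definition angle :: "real \<Rightarrow> real" where
  "angle p = arcsin (sqrt p)"

lemma angle_bounds:
  assumes "p \<in> {0..1}"
  shows "0 \<le> angle p" "angle p \<le> pi / 2"
proof -
  have s: "0 \<le> sqrt p" "sqrt p \<le> 1" using assms by auto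
  show "angle p \<le> pi / 2" using arcsin_ubound[of "sqrt p"] s by (simp add: angle_def)
  have "arcsin 0 \<le> arcsin (sqrt p)" using s by (intro arcsin_le_arcsin) auto
  then show "0 \<le> angle p" by (simp add: angle_def)
qed

lemma angle_mono:
  assumes "0 \<le> p" "p \<le> p'" "p' \<le> 1"
  shows "angle p \<le> angle p'"
  unfolding angle_def
proof (intro arcsin_le_arcsin)
  show "- 1 \<le> sqrt p" using assms real_sqrt_ge_zero[of p] by linarith
qed (use assms in auto)

lemma sin_angle: "p \<in> {0..1} \<Longrightarrow> sin (angle p) = sqrt p"
  unfolding angle_def by (intro sin_arcsin) (auto intro: order_trans[of _ 0])

lemma cos_angle:
  assumes "p \<in> {0..1}" shows "cos (angle p) = sqrt (1 - p)"
proof -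
  have "cos (angle p) = sqrt (1 - (sqrt p)\<^sup>2)"
    unfolding angle_def using assms by (intro cos_arcsin) (auto intro: order_trans[of _ 0])
  then show ?thesis using assms by simp
qed

lemma sin_double_angle: "p \<in> {0..1} \<Longrightarrow> sin (2 * angle p) = 2 * sqrt (p * (1 - p))"
  by (simp add: sin_double sin_angle cos_angle real_sqrt_mult)

lemma sin_angle_product:
  assumes "a \<in> {0..1}" "b \<in> {0..1}"
  shows "sin (angle a - angle b) * sin (angle a + angle b) = a - b"
proof -
  have "sin (angle a - angle b) * sin (angle a + angle b)
      = (sqrt a)\<^sup>2 * (sqrt (1 - b))\<^sup>2 - (sqrt (1 - a))\<^sup>2 * (sqrt b)\<^sup>2"
    using assms by (simp add: sin_diff sin_add sin_angle cos_angle power2_eq_square algebra_simps)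
  also have "\<dots> = a - b" using assms by (simp add: algebra_simps)
  finally show ?thesis .
qed

text \<open>
  The derivative of the angle at \<open>b\<close> is \<open>1/(2\<surd>(b(1-b)))\<close>; up to a constant this is a bound for all
  difference quotients based at \<open>b\<close>.
\<close>

lemma abs_angle_diff_le:
  assumes a: "a \<in> {0..1}" and b: "b \<in> {0..1}"
  shows "\<bar>angle a - angle b\<bar> * sqrt (b * (1 - b)) \<le> 2 * \<bar>a - b\<bar>"
proof -
  have A: "0 \<le> angle a" "angle a \<le> pi/2" "0 \<le> angle b" "angle b \<le> pi/2"
    using angle_bounds a b by auto
  have "\<bar>angle a - angle b\<bar> \<le> pi / 2" using A by linarith
  then have 1: "\<bar>angle a - angle b\<bar> / 2 \<le> sin \<bar>angle a - angle b\<bar>" by (intro half_le_sin) auto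
  have "sin \<bar>d\<bar> \<le> \<bar>sin d\<bar>" for d :: real by (cases "d < 0") auto
  with 1 have 1: "\<bar>angle a - angle b\<bar> / 2 \<le> \<bar>sin (angle a - angle b)\<bar>" by (rule order_trans)
  let ?s = "sin (angle a)" and ?c = "cos (angle a)" and ?t = "sin (angle b)" and ?d = "cos (angle b)"
  have nn: "0 \<le> ?s" "0 \<le> ?c" "0 \<le> ?t" "0 \<le> ?d" "?s \<le> 1" "?c \<le> 1" "?t \<le> 1" "?d \<le> 1"
    using a b by (auto simp: sin_angle cos_angle)
  have "1 = ?s\<^sup>2 + ?c\<^sup>2" by simp
  also have "\<dots> \<le> ?s + ?c" using nn by (intro add_mono) (auto simp: power2_eq_square mult_left_le)
  finally have "?t * ?d * 1 \<le> ?t * ?d * (?s + ?c)" using nn by (intro mult_left_mono) auto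
  also have "\<dots> = ?t * (?s * ?d) + ?d * (?c * ?t)" by (simp add: algebra_simps)
  also have "\<dots> \<le> 1 * (?s * ?d) + 1 * (?c * ?t)"
    using nn by (intro add_mono mult_right_mono) auto
  also have "\<dots> = sin (angle a + angle b)" by (simp add: sin_add)
  finally have 2: "sqrt (b * (1 - b)) \<le> sin (angle a + angle b)"
    using b by (simp add: sin_angle cos_angle real_sqrt_mult)
  have "0 \<le> b * (1 - b)" using b by auto
  then have "\<bar>angle a - angle b\<bar> / 2 * sqrt (b * (1 - b))
      \<le> \<bar>sin (angle a - angle b)\<bar> * sin (angle a + angle b)"
    using 1 2 by (intro mult_mono) auto
  also have "\<dots> = \<bar>sin (angle a - angle b) * sin (angle a + angle b)\<bar>"
    using 2 \<open>0 \<le> b * (1 - b)\<close> order_trans[of 0 "sqrt (b * (1 - b))" "sin (angle a + angle b)"]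
    by (simp add: abs_mult)
  also have "\<dots> = \<bar>a - b\<bar>" using sin_angle_product[OF a b] by simp
  finally show ?thesis by simp
qed

lemma binomial_mean_variance:
  assumes "m \<ge> 1"
  shows "binomial_mean m p (\<lambda>k. (real k / m - p)\<^sup>2) = p * (1 - p) / m"
proof -
  have "binomial_mean m p (\<lambda>k. (real k / m - p)\<^sup>2)
      = (\<Sum>k\<le>m. (real k * (real k - 1) * Bernstein m k p) / (real m)\<^sup>2
          + (1 / (real m)\<^sup>2 - 2 * p / m) * (real k * Bernstein m k p) + p\<^sup>2 * Bernstein m k p)"
    unfolding binomial_mean_def using assms
    by (intro sum.cong) (auto simp: field_simps power2_eq_square)
  also have "\<dots> = (real m * (real m - 1) * p\<^sup>2) / (real m)\<^sup>2
          + (1 / (real m)\<^sup>2 - 2 * p / m) * (real m * p) + p\<^sup>2 * 1"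
    by (simp only: sum.distrib sum_k_Bernstein sum_kk_Bernstein sum_Bernstein
        flip: sum_divide_distrib sum_distrib_left)
  also have "\<dots> = p * (1 - p) / m" using assms by (simp add: field_simps power2_eq_square)
  finally show ?thesis .
qed

text \<open>
  Chebyshev's inequality in the angular coordinate. No lower bound on \<open>mp(1-p)\<close> is needed: the factor
  \<open>p(1-p)\<close> of the variance cancels the one in \<open>abs_angle_diff_le\<close>.
\<close>

lemma angle_concentration:
  assumes p: "p \<in> {0..1}" and m: "m \<ge> 1"
  shows "binomial_mean m p (\<lambda>k. if \<bar>angle (k / m) - angle p\<bar> < 16 / sqrt m then 0 else 1) \<le> 1 / 64"
    (is "binomial_mean m p ?f \<le> _")
proof (cases "p = 0 \<or> p = 1")
  case True
  then have "Bernstein m k p * ?f k = 0" if "k \<le> m" for k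
    using m that by (cases "k = 0"; cases "k = m") (auto simp: Bernstein_def power_0_left)
  then have "binomial_mean m p ?f = 0"
    unfolding binomial_mean_def by (intro sum.neutral ballI) (simp only: atMost_iff)
  then show ?thesis by simp
next
  case False
  with p have pq: "0 < p * (1 - p)" by auto
  have pne: "p \<noteq> 0" "p \<noteq> 1" using False by auto
  have "binomial_mean m p ?f \<le> binomial_mean m p (\<lambda>k. m / (64 * (p * (1 - p))) * (real k / m - p)\<^sup>2)"
  proof (rule binomial_mean_mono[OF p])
    fix k assume k: "k \<le> m"
    show "?f k \<le> m / (64 * (p * (1 - p))) * (real k / m - p)\<^sup>2"
    proof (cases "\<bar>angle (k / m) - angle p\<bar> < 16 / sqrt m")
      case True then show ?thesis using pq by simp
    next
      case False
      have "16 / sqrt m * sqrt (p * (1 - p)) \<le> \<bar>angle (k / m) - angle p\<bar> * sqrt (p * (1 - p))"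
        using False pq by (intro mult_right_mono) auto
      also have "\<dots> \<le> 2 * \<bar>real k / m - p\<bar>"
        using k m p by (intro abs_angle_diff_le) (auto simp: divide_le_eq)
      finally have "8 / sqrt m * sqrt (p * (1 - p)) \<le> \<bar>real k / m - p\<bar>" by simp
      then have "(8 / sqrt m * sqrt (p * (1 - p)))\<^sup>2 \<le> \<bar>real k / m - p\<bar>\<^sup>2"
        using pq by (intro power_mono) auto
      then have "64 * (p * (1 - p)) / m \<le> (real k / m - p)\<^sup>2"
        using pq by (simp add: power_mult_distrib power_divide)
      then have "m / (64 * (p * (1 - p))) * (64 * (p * (1 - p)) / m) \<le> m / (64 * (p * (1 - p))) * (real k / m - p)\<^sup>2"
        using pq by (intro mult_left_mono) auto
      moreover have "m / (64 * (p * (1 - p))) * (64 * (p * (1 - p)) / m) = 1"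
        using pne m by simp
      ultimately show ?thesis using False by simp
    qed
  qed
  also have "\<dots> = 1 / 64"
  proof -
    show ?thesis
      unfolding binomial_mean_cmult binomial_mean_variance[OF m] using m pne by simp
  qed
  finally show ?thesis .
qed

section \<open>Windows\<close>

text \<open>
  The width of the cells in the angular coordinate: eight times the distance \<open>16/\<surd>m\<close> of
  \<open>angle_concentration\<close>.
\<close>

definition cell_width :: "nat \<Rightarrow> real" where
  "cell_width m = 128 / sqrt m"

text \<open>
  The affine function of the angle that rises from \<open>0\<close> to \<open>1\<close> over four cell widths, starting
  \<open>3/2\<close> widths before the left end of the cell \<open>j\<close>. On the cell itself it lies between \<open>3/8\<close> and
  \<open>5/8\<close>, and it stays in \<open>[0,1]\<close> on the two neighbouring cells with half a width to spare.
\<close>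

definition ramp :: "nat \<Rightarrow> nat \<Rightarrow> real \<Rightarrow> real" where
  "ramp m j t = (t - j * cell_width m) / (4 * cell_width m) + 3 / 8"

text \<open>
  The ramp truncated to \<open>[0,1]\<close>, as a function of the count \<open>k\<close>. The values at \<open>0\<close> and \<open>m\<close> are set to
  \<open>0\<close> and \<open>1\<close>: this preserves monotonicity in \<open>k\<close> and in \<open>j\<close>, only enlarges the increments, and makes
  the variance small when \<open>p\<close> is close to \<open>0\<close> or \<open>1\<close> (lemma \<open>window_mean_variance\<close>).
\<close>

definition window :: "nat \<Rightarrow> nat \<Rightarrow> nat \<Rightarrow> real" where
  "window m j k = (if k = 0 then 0 else if k \<ge> m then 1
     else max 0 (min 1 (ramp m j (angle (k / m)))))"

definition window_mean :: "nat \<Rightarrow> nat \<Rightarrow> real \<Rightarrow> real" where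
  "window_mean m j p = binomial_mean m p (window m j)"

lemma cell_width_pos: "m \<ge> 1 \<Longrightarrow> 0 < cell_width m"
  by (simp add: cell_width_def)

lemma window_range: "window m j k \<in> {0..1}"
  by (auto simp: window_def)

lemma window_mean_range:
  assumes "p \<in> {0..1}"
  shows "0 \<le> window_mean m j p" "window_mean m j p \<le> 1"
  unfolding window_mean_def using binomial_mean_bounds[of p "window m j" m] assms window_range by auto

lemma ramp_mono: "m \<ge> 1 \<Longrightarrow> s \<le> t \<Longrightarrow> ramp m j s \<le> ramp m j t"
  using cell_width_pos[of m] by (simp add: ramp_def divide_right_mono)

lemma ramp_antimono: "m \<ge> 1 \<Longrightarrow> i \<le> j \<Longrightarrow> ramp m j t \<le> ramp m i t"
  using cell_width_pos[of m] by (simp add: ramp_def divide_right_mono)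

lemma ramp_diff: "ramp m j s - ramp m j t = (s - t) / (4 * cell_width m)"
  by (simp add: ramp_def diff_divide_distrib)

lemma window_antimono:
  assumes "m \<ge> 1" "i \<le> j"
  shows "window m j k \<le> window m i k"
  using ramp_antimono[OF assms, of "angle (k / m)"] by (auto simp: window_def)

lemma angle_frac_mono:
  fixes k l m :: nat
  assumes "k \<le> l" "l \<le> m" shows "angle (real k / m) \<le> angle (real l / m)"
  using assms by (intro angle_mono) (auto simp: divide_le_eq_1 divide_right_mono)

lemma window_Suc_ge:
  assumes "k < m"
  shows "window m j k \<le> window m j (Suc k)"
  using ramp_mono[OF _ angle_frac_mono[of k "Suc k" m], of m j] assms
  by (auto simp: window_def simp del: of_nat_Suc)

lemma window_increment:
  assumes k: "k < m" and r: "0 \<le> ramp m j (angle (k / m))" "ramp m j (angle (Suc k / m)) \<le> 1"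
  shows "(angle (Suc k / m) - angle (k / m)) / (4 * cell_width m) \<le> window m j (Suc k) - window m j k"
proof -
  have mono: "ramp m j (angle (k / m)) \<le> ramp m j (angle (Suc k / m))"
    using k by (intro ramp_mono angle_frac_mono) auto
  have "window m j k \<le> ramp m j (angle (k / m))"
    using k r mono by (auto simp: window_def)
  moreover have "ramp m j (angle (Suc k / m)) \<le> window m j (Suc k)"
    using k r mono by (auto simp: window_def simp del: of_nat_Suc)
  ultimately show ?thesis by (simp add: ramp_diff[of m j, symmetric])
qed

lemma window_mean_variance:
  assumes p: "p \<in> {0..1}" and m: "m \<ge> 1"
  shows "min (window_mean m j p) (1 - window_mean m j p) \<le> 2 * (m * (p * (1 - p)))"
proof -
  have "window_mean m j p \<le> binomial_mean m p real"
    unfolding window_mean_def by (intro binomial_mean_mono[OF p]) (auto simp: window_def)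
  also have "\<dots> = m * p"
    using sum_k_Bernstein[of m p] by (simp add: binomial_mean_def mult.commute)
  finally have 1: "window_mean m j p \<le> m * p" .
  have "1 - window_mean m j p = binomial_mean m p (\<lambda>k. 1 - window m j k)"
    by (simp add: window_mean_def binomial_mean_diff)
  also have "\<dots> \<le> binomial_mean m p (\<lambda>k. real m - real k)"
    using m by (intro binomial_mean_mono[OF p]) (auto simp: window_def not_le intro: order_trans[of _ 1])
  also have "\<dots> = m * (1 - p)"
    using sum_k_Bernstein[of m p] unfolding binomial_mean_diff by (simp add: binomial_mean_def mult.commute right_diff_distrib)
  finally have 2: "1 - window_mean m j p \<le> m * (1 - p)" .
  show ?thesis
  proof (cases "p \<le> 1/2")
    case True
    then have "m * p * 1 \<le> m * p * (2 * (1 - p))" using p by (intro mult_left_mono) auto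
    then show ?thesis using 1 by (simp add: algebra_simps)
  next
    case False
    then have "m * (1 - p) * 1 \<le> m * (1 - p) * (2 * p)" using p by (intro mult_left_mono) auto
    then show ?thesis using 2 by (simp add: algebra_simps)
  qed
qed

lemma angle_step_le:
  fixes k m :: nat
  assumes "k < m"
  shows "angle (Suc k / m) - angle (k / m) \<le> cell_width m / 64"
proof -
  let ?a = "angle (Suc k / m)" and ?b = "angle (k / m)"
  have in01: "real (Suc k) / m \<in> {0..1}" "real k / m \<in> {0..1}"
    using assms by (auto simp: divide_le_eq_1)
  have ab: "0 \<le> ?b" "?b \<le> ?a" "?a \<le> pi/2"
    using angle_bounds[OF in01(1)] angle_bounds[OF in01(2)] angle_frac_mono[of k "Suc k" m] assms by auto
  have h: "(?a - ?b) / 2 \<le> sin (?a - ?b)" using ab by (intro half_le_sin) auto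
  have s0: "0 \<le> sin (?a - ?b)" using ab by (intro sin_ge_zero) auto
  have "sin (?a + ?b) - sin (?a - ?b) = 2 * (cos ?a * sin ?b)" by (simp add: sin_add sin_diff)
  moreover have "0 \<le> cos ?a * sin ?b" using in01 by (auto simp: sin_angle cos_angle)
  ultimately have "sin (?a - ?b) \<le> sin (?a + ?b)" by linarith
  then have "(sin (?a - ?b))\<^sup>2 \<le> sin (?a - ?b) * sin (?a + ?b)"
    unfolding power2_eq_square using s0 by (intro mult_left_mono) auto
  also have "\<dots> = 1 / m"
    unfolding sin_angle_product[OF in01] by (simp add: diff_divide_distrib[symmetric])
  finally have "sin (?a - ?b) \<le> sqrt (1 / m)" by (intro real_le_rsqrt)
  with h show ?thesis by (simp add: cell_width_def real_sqrt_divide)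
qed

lemma angle_step_ge:
  fixes k m :: nat
  assumes k: "k < m" and p: "p \<in> {0..1}"
    and near: "\<bar>angle (Suc k / m) - angle p\<bar> \<le> d" "\<bar>angle (k / m) - angle p\<bar> \<le> d"
  shows "1 / (m * (sin (2 * angle p) + 2 * d)) \<le> angle (Suc k / m) - angle (k / m)"
proof -
  let ?a = "angle (Suc k / m)" and ?b = "angle (k / m)"
  have in01: "real (Suc k) / m \<in> {0..1}" "real k / m \<in> {0..1}"
    using k by (auto simp: divide_le_eq_1)
  have ab: "?b \<le> ?a" using angle_frac_mono[of k "Suc k" m] k by auto
  have pr: "sin (?a - ?b) * sin (?a + ?b) = 1 / m"
    unfolding sin_angle_product[OF in01] by (simp add: diff_divide_distrib[symmetric])
  have "0 \<le> sin (?a + ?b)"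
    using angle_bounds[OF in01(1)] angle_bounds[OF in01(2)] by (intro sin_ge_zero) auto
  moreover have "sin (?a + ?b) \<noteq> 0" using pr k by auto
  ultimately have pos: "0 < sin (?a + ?b)" by simp
  have "\<bar>(?a + ?b) - 2 * angle p\<bar> \<le> 2 * d" using near by linarith
  then have le: "sin (?a + ?b) \<le> sin (2 * angle p) + 2 * d"
    using abs_sin_diff_le[of "?a + ?b" "2 * angle p"] by linarith
  have "1 / (m * (sin (2 * angle p) + 2 * d)) = 1 / m / (sin (2 * angle p) + 2 * d)" by simp
  also have "\<dots> \<le> 1 / m / sin (?a + ?b)" using le pos by (intro divide_left_mono) auto
  also have "\<dots> = sin (?a - ?b)" using pos by (simp flip: pr)
  also have "\<dots> \<le> ?a - ?b" using ab by (intro sin_x_le_x) auto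
  finally show ?thesis .
qed

text \<open>
  If \<open>p\<close> lies in the cell \<open>j\<close> or in a neighbouring one, then with probability at least one half the
  count falls where the ramp is not truncated. There one more success raises the angle by at least
  \<open>1/(m(sin 2\<theta> + h))\<close>, and the factor \<open>m\<close> of the derivative formula cancels the \<open>m\<close>.
\<close>

lemma window_mean_deriv_ge:
  assumes m: "m \<ge> 1" and p: "p \<in> {0..1}"
    and j: "(real j - 1) * cell_width m \<le> angle p" "angle p \<le> (real j + 2) * cell_width m"
  obtains D where "(window_mean m j has_real_derivative D) (at p)"
    "1 / (8 * cell_width m * (sin (2 * angle p) + cell_width m)) \<le> D"
proof -
  obtain m' where m': "m = Suc m'" using m by (cases m) auto
  define h where "h = cell_width m"
  have h: "0 < h" using cell_width_pos[OF m] by (simp add: h_def)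
  let ?D = "\<lambda>k. window m j (Suc k) - window m j k"
  define G where "G k \<longleftrightarrow> \<bar>angle (real k / m) - angle p\<bar> < 16 / sqrt m" for k :: nat
  have h8: "16 / sqrt m = h / 8" by (simp add: h_def cell_width_def)
  define g where "g k = (if G k \<or> G (Suc k) then 1 else 0 :: real)" for k
  have "binomial_mean m p (\<lambda>k. 1 - (if G k then 1 else 0)) \<le> 1 / 64"
    using angle_concentration[OF p m] by (simp add: G_def if_distrib cong: if_cong)
  then have "63 / 64 \<le> binomial_mean m p (\<lambda>k. if G k then 1 else 0)"
    by (simp add: binomial_mean_diff)
  also have "\<dots> = (1 - p) * binomial_mean m' p (\<lambda>k. if G k then 1 else 0)
      + p * binomial_mean m' p (\<lambda>k. if G (Suc k) then 1 else 0)"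
    by (simp add: m' binomial_mean_Suc)
  also have "\<dots> \<le> (1 - p) * binomial_mean m' p g + p * binomial_mean m' p g"
    using p by (intro add_mono mult_left_mono binomial_mean_mono[OF p]) (auto simp: g_def)
  \<comment> \<open>Adding one more trial changes the count by at most one, so \<open>g\<close> catches the
    concentration with \<open>m - 1\<close> trials.\<close>
  finally have half: "1 / 2 \<le> binomial_mean m' p g" by (simp add: algebra_simps)
  define s where "s = sin (2 * angle p) + h"
  have s: "0 < s" using h p by (auto simp: s_def sin_double_angle intro!: add_nonneg_pos)
  have "1 / (8 * h * s) = m * (1 / (m * s * (4 * h)) * (1 / 2))" using m h s by simp
  also have "\<dots> \<le> m * (1 / (m * s * (4 * h)) * binomial_mean m' p g)"
    using half m h s by (intro mult_left_mono) auto
  also have "\<dots> = m * binomial_mean m' p (\<lambda>k. 1 / (m * s * (4 * h)) * g k)"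
    by (simp only: binomial_mean_cmult)
  also have "\<dots> \<le> m * binomial_mean m' p ?D"
  proof (intro mult_left_mono binomial_mean_mono[OF p])
    fix k assume "k \<le> m'"
    then have k: "k < m" by (simp add: m')
    show "1 / (m * s * (4 * h)) * g k \<le> ?D k"
    proof (cases "G k \<or> G (Suc k)")
      case False
      then show ?thesis using window_Suc_ge[OF k] by (simp add: g_def)
    next
      case True
      have step: "angle (Suc k / m) - angle (k / m) \<le> h / 64" "angle (k / m) \<le> angle (Suc k / m)"
        using angle_step_le[OF k] angle_frac_mono[of k "Suc k" m] k by (auto simp: h_def)
      have near: "\<bar>angle (Suc k / m) - angle p\<bar> \<le> h / 2" "\<bar>angle (k / m) - angle p\<bar> \<le> h / 2"
        using True step h unfolding G_def h8 by linarith+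
      have jh: "real j * h - h \<le> angle p" "angle p \<le> real j * h + 2 * h"
        using j by (simp_all add: h_def algebra_simps)
      have lo: "0 \<le> ramp m j (angle (k / m))"
      proof -
        have "- (3 / 2) * h \<le> angle (k / m) - j * h" using near(2) jh by linarith
        then have "- (3 / 2) * h / (4 * h) \<le> (angle (k / m) - j * h) / (4 * h)"
          using h by (intro divide_right_mono) auto
        then show ?thesis using h by (simp add: ramp_def h_def[symmetric])
      qed
      have hi: "ramp m j (angle (Suc k / m)) \<le> 1"
      proof -
        have "angle (Suc k / m) - j * h \<le> 5 / 2 * h" using near(1) jh by linarith
        then have "(angle (Suc k / m) - j * h) / (4 * h) \<le> 5 / 2 * h / (4 * h)"
          using h by (intro divide_right_mono) auto
        also have "\<dots> = 5 / 8" using h by simp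
        finally show ?thesis unfolding ramp_def h_def[symmetric] by linarith
      qed
      have "1 / (m * s) \<le> angle (Suc k / m) - angle (k / m)"
        using angle_step_ge[OF k p near] by (simp add: s_def)
      then have "1 / (m * s) / (4 * h) \<le> (angle (Suc k / m) - angle (k / m)) / (4 * h)"
        using h by (intro divide_right_mono) auto
      also have "\<dots> \<le> ?D k" using window_increment[OF k lo hi] by (simp add: h_def)
      finally show ?thesis using True by (simp add: g_def)
    qed
  qed auto
  finally have "1 / (8 * h * s) \<le> m * binomial_mean m' p ?D" .
  moreover have "(window_mean m j has_real_derivative m * binomial_mean m' p ?D) (at p)"
    using binomial_mean_has_derivative[of m' "window m j" p] by (simp add: window_mean_def[abs_def] m')
  ultimately show ?thesis by (intro that) (auto simp: h_def s_def)
qed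

text \<open>
  The mean value theorem applied to the preceding derivative bound: over three adjacent cells the
  angle changes by at most \<open>3h\<close>, hence \<open>sin 2\<theta>\<close> by at most \<open>6h\<close>.
\<close>

lemma window_mean_injective:
  assumes m: "m \<ge> 1" and p: "p \<in> {0..1}" "p' \<in> {0..1}"
    and j: "(real j - 1) * cell_width m \<le> angle p" "angle p \<le> (real j + 2) * cell_width m"
    and j': "(real j - 1) * cell_width m \<le> angle p'" "angle p' \<le> (real j + 2) * cell_width m"
  shows "\<bar>p - p'\<bar> \<le> 8 * cell_width m * (sin (2 * angle p) + 7 * cell_width m)
      * \<bar>window_mean m j p - window_mean m j p'\<bar>"
proof -
  define h where "h = cell_width m"
  have h: "0 < h" using cell_width_pos[OF m] by (simp add: h_def)
  define K where "K = 8 * h * (sin (2 * angle p) + 7 * h)"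
  have s0: "0 \<le> sin (2 * angle x)" if "x \<in> {0..1}" for x
    using that by (auto simp: sin_double_angle)
  have K: "0 < K" using h s0[OF p(1)] by (simp add: K_def add_nonneg_pos)
  have *: "b - a \<le> K * (window_mean m j b - window_mean m j a)"
    if ab: "a < b" "a \<in> {0..1}" "b \<in> {0..1}" "p = a \<or> p = b"
      "real j * h - h \<le> angle a" "angle b \<le> real j * h + 2 * h" for a b
  proof -
    have *: "\<exists>D. (window_mean m j has_real_derivative D) (at x) \<and> 1 / K \<le> D" if x: "a \<le> x" "x \<le> b" for x
    proof -
      have x01: "x \<in> {0..1}" using x ab by auto
      have ax: "angle a \<le> angle x" "angle x \<le> angle b" using x ab by (auto intro!: angle_mono)
      obtain D where D: "(window_mean m j has_real_derivative D) (at x)"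
          "1 / (8 * h * (sin (2 * angle x) + h)) \<le> D"
        using window_mean_deriv_ge[OF m x01, of j] ax ab by (auto simp: h_def algebra_simps)
      have "\<bar>2 * angle x - 2 * angle p\<bar> \<le> 6 * h" using ax ab by auto
      then have "sin (2 * angle x) \<le> sin (2 * angle p) + 6 * h"
        using abs_sin_diff_le[of "2 * angle x" "2 * angle p"] by linarith
      then have "8 * h * (sin (2 * angle x) + h) \<le> K"
        unfolding K_def using h by (intro mult_left_mono) auto
      moreover have "0 < 8 * h * (sin (2 * angle x) + h)"
        using h s0[OF x01] by (simp add: add_nonneg_pos)
      ultimately have "1 / K \<le> 1 / (8 * h * (sin (2 * angle x) + h))"
        by (intro divide_left_mono) (auto intro: mult_pos_pos K)
      with D show ?thesis by (meson order_trans)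
    qed
    then obtain f' where f': "\<And>x. a \<le> x \<Longrightarrow> x \<le> b \<Longrightarrow> (window_mean m j has_real_derivative f' x) (at x)"
        "\<And>x. a \<le> x \<Longrightarrow> x \<le> b \<Longrightarrow> 1 / K \<le> f' x" by metis
    obtain z where z: "a < z" "z < b" "window_mean m j b - window_mean m j a = (b - a) * f' z"
      using MVT2[OF ab(1), of "window_mean m j" f'] f'(1) by auto
    have "(b - a) * (1 / K) \<le> window_mean m j b - window_mean m j a"
      unfolding z(3) using f'(2)[of z] z ab by (intro mult_left_mono) auto
    then show ?thesis using K by (simp add: field_simps)
  qed
  have jh: "real j * h - h \<le> angle p" "angle p \<le> real j * h + 2 * h"
      "real j * h - h \<le> angle p'" "angle p' \<le> real j * h + 2 * h"
    using j j' by (simp_all add: h_def algebra_simps)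
  have "\<bar>p - p'\<bar> \<le> K * \<bar>window_mean m j p - window_mean m j p'\<bar>"
  proof (cases p p' rule: linorder_cases)
    case less
    have "p' - p \<le> K * (window_mean m j p' - window_mean m j p)" using less p jh by (intro *) auto
    also have "\<dots> \<le> K * \<bar>window_mean m j p - window_mean m j p'\<bar>" using K by (intro mult_left_mono) auto
    finally show ?thesis using less by simp
  next
    case greater
    have "p - p' \<le> K * (window_mean m j p - window_mean m j p')" using greater p jh by (intro *) auto
    also have "\<dots> \<le> K * \<bar>window_mean m j p - window_mean m j p'\<bar>" using K by (intro mult_left_mono) auto
    finally show ?thesis using greater by simp
  qed auto
  then show ?thesis by (simp add: K_def h_def)
qed

lemma binomial_mean_concentrated_le:
  assumes p: "p \<in> {0..1}" and m: "m \<ge> 1" and c: "0 \<le> c"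
    and f: "\<And>k. f k \<le> 1"
    and near: "\<And>k. k \<le> m \<Longrightarrow> \<bar>angle (k / m) - angle p\<bar> < cell_width m / 8 \<Longrightarrow> f k \<le> c"
  shows "binomial_mean m p f \<le> c + 1 / 64"
proof -
  let ?o = "\<lambda>k. if \<bar>angle (k / m) - angle p\<bar> < 16 / sqrt m then 0 else 1 :: real"
  have "binomial_mean m p f \<le> binomial_mean m p (\<lambda>k. c + ?o k)"
    using near f c by (intro binomial_mean_mono[OF p]) (auto simp: cell_width_def intro: order_trans[of _ 1])
  then show ?thesis using angle_concentration[OF p m] by (simp add: binomial_mean_add)
qed

lemma window_mean_le:
  assumes p: "p \<in> {0..1}" and m: "m \<ge> 1" and c: "0 \<le> c"
    and r: "ramp m j (angle p + cell_width m / 8) \<le> c"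
    and top: "angle p + cell_width m / 8 \<le> pi / 2"
  shows "window_mean m j p \<le> c + 1 / 64"
  unfolding window_mean_def
proof (rule binomial_mean_concentrated_le[OF p m c])
  fix k :: nat assume k: "k \<le> m" "\<bar>angle (k / m) - angle p\<bar> < cell_width m / 8"
  have "ramp m j (angle (k / m)) \<le> ramp m j (angle p + cell_width m / 8)"
    using k by (intro ramp_mono m) linarith
  moreover have "k \<noteq> m"
  proof
    assume "k = m"
    then have "angle (k / m) = pi / 2" using m by (simp add: angle_def)
    then show False using k top by linarith
  qed
  ultimately show "window m j k \<le> c" using k c r by (auto simp: window_def)
qed (use window_range in auto)

lemma window_mean_ge:
  assumes p: "p \<in> {0..1}" and m: "m \<ge> 1" and c: "c \<le> 1"
    and r: "c \<le> ramp m j (angle p - cell_width m / 8)"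
    and bot: "0 \<le> angle p - cell_width m / 8"
  shows "c - 1 / 64 \<le> window_mean m j p"
proof -
  have "binomial_mean m p (\<lambda>k. 1 - window m j k) \<le> (1 - c) + 1 / 64"
  proof (rule binomial_mean_concentrated_le[OF p m])
    fix k :: nat assume k: "k \<le> m" "\<bar>angle (k / m) - angle p\<bar> < cell_width m / 8"
    have "ramp m j (angle p - cell_width m / 8) \<le> ramp m j (angle (k / m))"
      using k by (intro ramp_mono m) linarith
    moreover have "k \<noteq> 0"
    proof
      assume "k = 0"
      then have "angle (k / m) = 0" by (simp add: angle_def)
      then show False using k bot by linarith
    qed
    ultimately show "1 - window m j k \<le> 1 - c" using c r by (auto simp: window_def)
  qed (use window_range c in auto)
  then show ?thesis by (simp add: binomial_mean_diff window_mean_def)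
qed

text \<open>
  The bounds come from the ramp, at most \<open>21/32\<close> for \<open>p'\<close> and at least \<open>27/32\<close> for \<open>p\<close> on the event of
  \<open>angle_concentration\<close>, with an error of \<open>1/64\<close> for its complement. The values assigned to the
  window at \<open>0\<close> and \<open>m\<close> do not interfere: the angles of \<open>p\<close> and \<open>p'\<close> are too far from \<open>0\<close> and
  \<open>\<pi>/2\<close> respectively.
\<close>

lemma window_mean_separation_below:
  assumes m: "m \<ge> 1" and p: "p \<in> {0..1}" and p': "p' \<in> {0..1}"
    and j: "angle p' \<le> (real j + 1) * cell_width m" and i: "(real i + 2) * cell_width m \<le> angle p"
    and ij: "j \<le> i"
  shows "window_mean m j p' + 1 / 8 < window_mean m i p"
proof -
  define h where "h = cell_width m"
  have h: "0 < h" using cell_width_pos[OF m] by (simp add: h_def)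
  have jh: "angle p' \<le> j * h + h" "i * h + 2 * h \<le> angle p" using i j by (simp_all add: h_def algebra_simps)
  have ijh: "j * h \<le> i * h" using ij h by simp
  have "window_mean m j p' \<le> 21 / 32 + 1 / 64"
  proof (rule window_mean_le[OF p' m])
    have "angle p' + h / 8 - j * h \<le> 9 / 8 * h" using jh by linarith
    then have "(angle p' + h / 8 - j * h) / (4 * h) \<le> 9 / 8 * h / (4 * h)" using h by (intro divide_right_mono) auto
    then show "ramp m j (angle p' + cell_width m / 8) \<le> 21 / 32"
      using h by (simp add: ramp_def h_def[symmetric])
    show "angle p' + cell_width m / 8 \<le> pi / 2"
      using jh ijh h angle_bounds(2)[OF p] unfolding h_def[symmetric] by linarith
  qed auto
  moreover have "27 / 32 - 1 / 64 \<le> window_mean m i p"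
  proof (rule window_mean_ge[OF p m])
    have "15 / 8 * h \<le> angle p - h / 8 - i * h" using jh by linarith
    then have "15 / 8 * h / (4 * h) \<le> (angle p - h / 8 - i * h) / (4 * h)" using h by (intro divide_right_mono) auto
    then show "27 / 32 \<le> ramp m i (angle p - cell_width m / 8)"
      using h by (simp add: ramp_def h_def[symmetric])
    have "0 \<le> i * h" using h by simp
    then show "0 \<le> angle p - cell_width m / 8"
      using jh h unfolding h_def[symmetric] by linarith
  qed auto
  ultimately show ?thesis by simp
qed

lemma window_mean_separation_above:
  assumes m: "m \<ge> 1" and p: "p \<in> {0..1}" and p': "p' \<in> {0..1}"
    and j: "real j * cell_width m \<le> angle p'" and i: "angle p \<le> (real i - 1) * cell_width m"
    and ij: "1 \<le> i" "i \<le> j"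
  shows "window_mean m i p + 1 / 8 < window_mean m j p'"
proof -
  define h where "h = cell_width m"
  have h: "0 < h" using cell_width_pos[OF m] by (simp add: h_def)
  have jh: "j * h \<le> angle p'" "angle p \<le> i * h - h" using i j by (simp_all add: h_def algebra_simps)
  have ijh: "i * h \<le> j * h" "1 * h \<le> i * h" using ij h by simp_all
  have "window_mean m i p \<le> 5 / 32 + 1 / 64"
  proof (rule window_mean_le[OF p m])
    have "angle p + h / 8 - i * h \<le> - (7 / 8) * h" using jh by linarith
    then have "(angle p + h / 8 - i * h) / (4 * h) \<le> - (7 / 8) * h / (4 * h)" using h by (intro divide_right_mono) auto
    also have "\<dots> = - (7 / 32)" using h by simp
    finally show "ramp m i (angle p + cell_width m / 8) \<le> 5 / 32"
      unfolding ramp_def h_def[symmetric] by linarith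
    show "angle p + cell_width m / 8 \<le> pi / 2"
      using jh ijh h angle_bounds(2)[OF p'] unfolding h_def[symmetric] by linarith
  qed auto
  moreover have "11 / 32 - 1 / 64 \<le> window_mean m j p'"
  proof (rule window_mean_ge[OF p' m])
    have "- (1 / 8) * h \<le> angle p' - h / 8 - j * h" using jh by linarith
    then have "- (1 / 8) * h / (4 * h) \<le> (angle p' - h / 8 - j * h) / (4 * h)" using h by (intro divide_right_mono) auto
    moreover have "- (1 / 8) * h / (4 * h) = - (1 / 32)" using h by simp
    ultimately show "11 / 32 \<le> ramp m j (angle p' - cell_width m / 8)"
      unfolding ramp_def h_def[symmetric] by linarith
    show "0 \<le> angle p' - cell_width m / 8"
      using jh ijh h unfolding h_def[symmetric] by linarith
  qed auto
  ultimately show ?thesis by simp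
qed

section \<open>The confidence interval\<close>

text \<open>
  The index of the cell that contains the angle of \<open>p\<close>.
\<close>

definition cell :: "nat \<Rightarrow> real \<Rightarrow> nat" where
  "cell m p = nat \<lfloor>angle p / cell_width m\<rfloor>"

lemma cell_bounds:
  assumes "m \<ge> 1" "p \<in> {0..1}"
  shows "real (cell m p) * cell_width m \<le> angle p" "angle p \<le> (real (cell m p) + 1) * cell_width m"
proof -
  have h: "0 < cell_width m" by (rule cell_width_pos[OF assms(1)])
  have "0 \<le> angle p / cell_width m" using angle_bounds(1)[OF assms(2)] h by simp
  then have c: "real (cell m p) = of_int \<lfloor>angle p / cell_width m\<rfloor>" by (simp add: cell_def)
  have "real (cell m p) \<le> angle p / cell_width m" "angle p / cell_width m \<le> real (cell m p) + 1"
    unfolding c by linarith+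
  then show "real (cell m p) * cell_width m \<le> angle p" "angle p \<le> (real (cell m p) + 1) * cell_width m"
    using h by (simp_all add: field_simps)
qed

text \<open>
  The sample \<open>x\<close> is compatible with the value \<open>p\<close> as far as the window of the cell \<open>j\<close> can tell.
\<close>

definition accepts :: "nat \<Rightarrow> nat \<Rightarrow> real \<Rightarrow> real \<Rightarrow> nat \<Rightarrow> real \<Rightarrow> (nat \<Rightarrow> real) \<Rightarrow> bool" where
  "accepts n m \<epsilon> L j p x \<longleftrightarrow>
     \<bar>empirical_mean n m (window m j) x - window_mean m j p\<bar> \<le> radius n \<epsilon> L (window_mean m j p)"

text \<open>
  Each value is tested with the window of its own cell only.
\<close>

definition accepted_set :: "nat \<Rightarrow> nat \<Rightarrow> real \<Rightarrow> real \<Rightarrow> (nat \<Rightarrow> real) \<Rightarrow> real set" where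
  "accepted_set n m \<epsilon> L x = {p \<in> {0..1}. accepts n m \<epsilon> L (cell m p) p x}"

text \<open>
  The interval spanned by the accepted values. Where no value is accepted the endpoints are
  unspecified reals; this happens only outside the event \<open>typical\<close> defined below.
\<close>

definition robust_ci :: "nat \<Rightarrow> nat \<Rightarrow> real \<Rightarrow> real \<Rightarrow> interval_fn" where
  "robust_ci n m \<epsilon> L = (\<lambda>x. Inf (accepted_set n m \<epsilon> L x), \<lambda>x. Sup (accepted_set n m \<epsilon> L x))"

text \<open>
  A function of the sample that depends only on the rounded observations takes finitely many values,
  each on a measurable set.
\<close>

lemma measurable_of_bin_indices:
  fixes F :: "(nat \<Rightarrow> real) \<Rightarrow> real"
  assumes "\<And>x y. (\<And>i. i < n \<Longrightarrow> bin_index m (x i) = bin_index m (y i)) \<Longrightarrow> F x = F y"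
  shows "F \<in> borel_measurable (PiM {..<n} (\<lambda>_. borel))"
proof -
  let ?P = "PiM {..<n} (\<lambda>_. borel :: real measure)"
  let ?S = "PiE {..<n} (\<lambda>_. {..m})"
  define K where "K x = (\<lambda>i\<in>{..<n}. bin_index m (x i))" for x
  have "K \<in> ?P \<rightarrow>\<^sub>M count_space ?S"
  proof (subst measurable_count_space_eq2)
    show "finite ?S" by (intro finite_PiE) auto
    show "K \<in> space ?P \<rightarrow> ?S \<and> (\<forall>a\<in>?S. K -` {a} \<inter> space ?P \<in> sets ?P)"
    proof (intro conjI ballI)
      show "K \<in> space ?P \<rightarrow> ?S" by (auto simp: K_def)
      fix a assume a: "a \<in> ?S"
      have "K -` {a} \<inter> space ?P = {x \<in> space ?P. \<forall>i\<in>{..<n}. bin_index m (x i) = a i}"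
      proof (intro set_eqI iffI)
        fix x assume x: "x \<in> {x \<in> space ?P. \<forall>i\<in>{..<n}. bin_index m (x i) = a i}"
        have "K x = a" using x a by (intro PiE_ext[of "K x" "{..<n}" "\<lambda>_. {..m}" a]) (auto simp: K_def)
        then show "x \<in> K -` {a} \<inter> space ?P" using x by auto
      qed (auto simp: K_def)
      also have "\<dots> \<in> sets ?P" by measurable
      finally show "K -` {a} \<inter> space ?P \<in> sets ?P" .
    qed
  qed
  then have "(\<lambda>x. F (\<lambda>i. real (K x i))) \<in> borel_measurable ?P"
    by (rule measurable_compose[where g="\<lambda>f. F (\<lambda>i. real (f i))"]) simp
  also have "(\<lambda>x. F (\<lambda>i. real (K x i))) = F"
    by (intro ext assms) (simp add: K_def)
  finally show ?thesis .
qed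

lemma robust_ci_in_intervals: "robust_ci n m \<epsilon> L \<in> intervals n"
proof -
  have eq: "accepted_set n m \<epsilon> L x = accepted_set n m \<epsilon> L y"
    if "\<And>i. i < n \<Longrightarrow> bin_index m (x i) = bin_index m (y i)" for x y
    using that by (simp add: accepted_set_def accepts_def empirical_mean_def)
  have "(\<lambda>x. Inf (accepted_set n m \<epsilon> L x)) \<in> borel_measurable (PiM {..<n} (\<lambda>_. borel))"
    "(\<lambda>x. Sup (accepted_set n m \<epsilon> L x)) \<in> borel_measurable (PiM {..<n} (\<lambda>_. borel))"
    by (rule measurable_of_bin_indices[of n m], subst eq, assumption, rule refl)+
  then show ?thesis by (simp add: intervals_def robust_ci_def)
qed

lemma empirical_mean_window_antimono:
  assumes "m \<ge> 1" "i \<le> j"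
  shows "empirical_mean n m (window m j) x \<le> empirical_mean n m (window m i) x"
  unfolding empirical_mean_def using window_antimono[OF assms] by (intro divide_right_mono sum_mono) auto

text \<open>
  The event on which the interval behaves well for the true value \<open>p\<close>: the five windows around its
  cell are compatible with \<open>p\<close>. The subtraction truncates at zero, where the first cell is.
\<close>

definition typical :: "nat \<Rightarrow> nat \<Rightarrow> real \<Rightarrow> real \<Rightarrow> real \<Rightarrow> (nat \<Rightarrow> real) \<Rightarrow> bool" where
  "typical n m \<epsilon> L p x \<longleftrightarrow> (\<forall>j \<in> {cell m p - 2..cell m p + 2}. accepts n m \<epsilon> L j p x)"

text \<open>
  The empirical means are monotone in the index of the window, so the windows two cells to the left
  and to the right of the cell of \<open>p\<close> rule out all values beyond them at once.
\<close>

lemma accepted_in_neighbouring_cell: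
  assumes m: "m \<ge> 1" and p: "p \<in> {0..1}" and q: "q \<in> accepted_set n m \<epsilon> L x"
    and good: "typical n m \<epsilon> L p x"
    and small: "\<And>\<mu>. 0 \<le> \<mu> \<Longrightarrow> \<mu> \<le> 1 \<Longrightarrow> radius n \<epsilon> L \<mu> \<le> 1 / 16"
  shows "cell m q \<le> cell m p + 1" "cell m p \<le> cell m q + 1"
proof -
  have q01: "q \<in> {0..1}" and acc: "accepts n m \<epsilon> L (cell m q) q x"
    using q by (auto simp: accepted_set_def)
  let ?T = "\<lambda>j. empirical_mean n m (window m j) x"
  have near: "\<bar>?T j - window_mean m j s\<bar> \<le> 1 / 16" if "accepts n m \<epsilon> L j s x" "s \<in> {0..1}" for j s
    using that small[OF window_mean_range[OF that(2), of m j]] by (simp add: accepts_def)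
  show "cell m p \<le> cell m q + 1"
  proof (rule ccontr)
    assume "\<not> cell m p \<le> cell m q + 1"
    then have far: "cell m q + 2 \<le> cell m p" by simp
    define i where "i = cell m p - 2"
    have i: "cell m q \<le> i" "real i + 2 = cell m p" using far by (auto simp: i_def of_nat_diff)
    have "window_mean m (cell m q) q + 1 / 8 < window_mean m i p"
      using cell_bounds[OF m p] cell_bounds[OF m q01] i
      by (intro window_mean_separation_below m p q01) auto
    moreover have "accepts n m \<epsilon> L i p x" using good by (auto simp: typical_def i_def)
    note near[OF this p]
    ultimately show False
      using near[OF acc q01] empirical_mean_window_antimono[OF m i(1), of n x] by linarith
  qed
  show "cell m q \<le> cell m p + 1"
  proof (rule ccontr)
    assume "\<not> cell m q \<le> cell m p + 1"
    then have far: "cell m p + 2 \<le> cell m q" by simp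
    have "window_mean m (cell m p + 2) p + 1 / 8 < window_mean m (cell m q) q"
      using cell_bounds[OF m p] cell_bounds[OF m q01] far
      by (intro window_mean_separation_above m p q01) (auto simp: algebra_simps)
    moreover have "accepts n m \<epsilon> L (cell m p + 2) p x" using good by (auto simp: typical_def)
    note near[OF this p]
    ultimately show False
      using near[OF acc q01] empirical_mean_window_antimono[OF m far, of n x] by linarith
  qed
qed

text \<open>
  If one statistic \<open>t\<close> is compatible with both means, then their difference is controlled by the
  variance proxy of \<open>\<mu>\<close> alone. The proxy of \<open>\<nu>\<close> exceeds it by at most the difference itself, which
  enters under a square root and can be absorbed.
\<close>

lemma self_bounding_radius:
  fixes \<mu> \<nu> \<epsilon> L t :: real and n :: nat
  assumes \<epsilon>: "0 \<le> \<epsilon>" and L: "0 \<le> L" and \<mu>: "0 \<le> \<mu>" "\<mu> \<le> 1" and \<nu>: "0 \<le> \<nu>" "\<nu> \<le> 1"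
    and t: "\<bar>t - \<mu>\<bar> \<le> radius n \<epsilon> L \<mu>" "\<bar>t - \<nu>\<bar> \<le> radius n \<epsilon> L \<nu>"
  shows "\<bar>\<mu> - \<nu>\<bar> \<le> 8 * \<epsilon> + 8 * sqrt (min \<mu> (1 - \<mu>) * (L / n)) + 16 * (L / n)"
proof -
  define l where "l = L / n"
  have l: "0 \<le> l" using L by (simp add: l_def)
  define v where "v = min \<mu> (1 - \<mu>)"
  have v: "0 \<le> v" using \<mu> by (simp add: v_def)
  define d where "d = \<bar>\<mu> - \<nu>\<bar>"
  have d: "0 \<le> d" by (simp add: d_def)
  have "min \<nu> (1 - \<nu>) \<le> v + d" by (auto simp: v_def d_def min_def abs_if)
  then have "sqrt (min \<nu> (1 - \<nu>) * l) \<le> sqrt (v * l + d * l)"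
    using l by (simp add: mult_right_mono flip: distrib_right)
  also have "\<dots> \<le> sqrt (v * l) + sqrt (d * l)" using v l d by (intro sqrt_add_le_add_sqrt) auto
  finally have 1: "sqrt (min \<nu> (1 - \<nu>) * l) \<le> sqrt (v * l) + sqrt (d * l)" .
  have "sqrt (d * l) = sqrt ((d / 2) * (2 * l))" by simp
  also have "\<dots> \<le> (d / 2 + 2 * l) / 2" using d l by (intro arith_geo_mean_sqrt) auto
  also have "\<dots> = d / 4 + l" by simp
  finally have 2: "sqrt (d * l) \<le> d / 4 + l" .
  have "\<bar>t - \<mu>\<bar> \<le> 2 * \<epsilon> + 2 * sqrt (v * l) + 3 * l" "\<bar>t - \<nu>\<bar> \<le> 2 * \<epsilon> + 2 * sqrt (min \<nu> (1 - \<nu>) * l) + 3 * l"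
    using t by (simp_all add: radius_def v_def l_def)
  moreover have "d \<le> \<bar>t - \<mu>\<bar> + \<bar>t - \<nu>\<bar>" by (simp add: d_def)
  ultimately have "d \<le> 8 * \<epsilon> + 8 * sqrt (v * l) + 16 * l" using 1 2 by linarith
  then show ?thesis by (simp add: d_def v_def l_def)
qed

text \<open>
  On the typical event every accepted value is within the rate of the true one.
\<close>

lemma accepted_close:
  assumes m: "m \<ge> 1" and n: "n \<ge> 1" and \<epsilon>: "0 \<le> \<epsilon>" and L: "0 \<le> L"
    and p: "p \<in> {0..1}" and q: "q \<in> accepted_set n m \<epsilon> L x"
    and good: "typical n m \<epsilon> L p x"
    and small: "\<And>\<mu>. 0 \<le> \<mu> \<Longrightarrow> \<mu> \<le> 1 \<Longrightarrow> radius n \<epsilon> L \<mu> \<le> 1 / 16"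
  shows "\<bar>p - q\<bar> \<le> 40000000 * (1 + L) * rate n m \<epsilon> p"
proof -
  have q01: "q \<in> {0..1}" and acc: "accepts n m \<epsilon> L (cell m q) q x"
    using q by (auto simp: accepted_set_def)
  define j where "j = cell m q"
  note cells = accepted_in_neighbouring_cell[OF m p q good small]
  have accp: "accepts n m \<epsilon> L j p x" using good cells by (auto simp: typical_def j_def)
  define h where "h = cell_width m"
  have h: "0 < h" using cell_width_pos[OF m] by (simp add: h_def)
  define A B where "A = sqrt (p * (1 - p) / m)" and "B = 1 / real m"
  define v where "v = min (window_mean m j p) (1 - window_mean m j p)"
  define D where "D = 8 * \<epsilon> + 8 * sqrt (v * (L / n)) + 16 * (L / n)"
  have pq: "0 \<le> p * (1 - p)" using p by auto
  have AB: "0 \<le> A" "0 \<le> B" using pq by (auto simp: A_def B_def)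
  have v: "0 \<le> v" "v \<le> 1" "v \<le> 2 * (m * (p * (1 - p)))"
    using window_mean_range[OF p, of m j] window_mean_variance[OF p m, of j] by (auto simp: v_def)
  have diff: "\<bar>window_mean m j p - window_mean m j q\<bar> \<le> D"
    unfolding D_def v_def
    by (rule self_bounding_radius[OF \<epsilon> L])
       (use window_mean_range p q01 accp acc in \<open>auto simp: accepts_def j_def\<close>)
  have "real (cell m p) * h \<le> (real j + 1) * h" "(real j - 1) * h \<le> real (cell m p) * h"
    using cells h by (auto simp: j_def)
  then have "(real j - 1) * h \<le> angle p" "angle p \<le> (real j + 2) * h"
      "(real j - 1) * h \<le> angle q" "angle q \<le> (real j + 2) * h"
    using cell_bounds[OF m p] cell_bounds[OF m q01] h
    unfolding j_def[symmetric] h_def[symmetric] by (simp_all add: algebra_simps)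
  then have "\<bar>p - q\<bar> \<le> 8 * h * (sin (2 * angle p) + 7 * h) * \<bar>window_mean m j p - window_mean m j q\<bar>"
    unfolding h_def by (intro window_mean_injective m p q01)
  also have "\<dots> \<le> 8 * h * (sin (2 * angle p) + 7 * h) * D"
    using diff h p pq by (intro mult_left_mono) (auto simp: sin_double_angle)
  also have "8 * h * (sin (2 * angle p) + 7 * h) = 2048 * A + 917504 * B"
  proof -
    have "sqrt (p * (1 - p)) / sqrt m = A" by (simp add: A_def real_sqrt_divide)
    moreover have "h * h = 16384 * B" using m by (simp add: h_def cell_width_def B_def)
    moreover have "8 * h * (sin (2 * angle p) + 7 * h)
        = 2048 * (sqrt (p * (1 - p)) / sqrt m) + 56 * (h * h)"
    proof -
      have "8 * h * (2 * s + 7 * h) = 16 * (h * s) + 56 * (h * h)" for s :: real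
        by (simp add: algebra_simps)
      moreover have "16 * (h * s) = 2048 * (s / sqrt m)" for s :: real
        by (simp add: h_def cell_width_def)
      ultimately show ?thesis by (simp only: sin_double_angle[OF p])
    qed
    ultimately show ?thesis by simp
  qed
  also have "(2048 * A + 917504 * B) * D \<le> 1000000 * (A * D + B * D)"
  proof -
    have "0 \<le> D" using \<epsilon> L v by (simp add: D_def)
    then have "0 \<le> A * D" "0 \<le> B * D" using AB by auto
    then show ?thesis by (simp add: algebra_simps)
  qed
  also have "A * D + B * D \<le> 40 * (1 + L) * rate n m \<epsilon> p"
  proof -
    have sn: "1 \<le> sqrt n" using n by simp
    define r where "r = 1 / sqrt n"
    have r: "0 < r" "r \<le> 1" "1 / real n = r * r" using sn n by (auto simp: r_def)
    have rr: "1 / real n \<le> r" using r by (simp add: mult_left_le)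
    have sL: "sqrt L \<le> 1 + L"
    proof -
      have "L \<le> (1 + L)\<^sup>2" using L by (simp add: power2_eq_square algebra_simps)
      then show ?thesis using L by (intro real_le_lsqrt) auto
    qed
    \<comment> \<open>The pure sampling term uses only \<open>v \<le> 1\<close>.\<close>
    have s1: "sqrt (v * (L / n)) \<le> (1 + L) * r"
    proof -
      have "sqrt (v * (L / n)) \<le> sqrt (1 * (L / n))"
        using v L by (intro real_sqrt_le_mono mult_right_mono) auto
      also have "\<dots> = sqrt L * r" by (simp add: real_sqrt_divide r_def)
      also have "\<dots> \<le> (1 + L) * r" using sL r by (intro mult_right_mono) auto
      finally show ?thesis .
    qed
    \<comment> \<open>The bound \<open>v \<le> 2mp(1-p)\<close> reduces this mixed term to the first part of the
      rate.\<close>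
    have s2: "B * sqrt (v * (L / n)) \<le> 2 * (1 + L) * (A * r)"
    proof -
      have "B * sqrt (v * (L / n)) = B * sqrt v * (sqrt L * r)"
        by (simp add: real_sqrt_mult real_sqrt_divide r_def)
      also have "B * sqrt v \<le> 2 * A"
      proof -
        have "sqrt v \<le> sqrt (4 * (m * (p * (1 - p))))" using v pq by (intro real_sqrt_le_mono) auto
        also have "4 * (m * (p * (1 - p))) = (2 * real m)\<^sup>2 * (p * (1 - p) / m)"
          using m by (simp add: power2_eq_square)
        also have "sqrt \<dots> = 2 * m * A" by (simp only: real_sqrt_mult real_sqrt_abs A_def)
        finally show ?thesis using m by (simp add: B_def field_simps)
      qed
      also have "2 * A * (sqrt L * r) \<le> 2 * A * ((1 + L) * r)"
        using sL r AB by (intro mult_left_mono mult_right_mono) auto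
      finally show ?thesis using r L by (simp add: mult_ac mult_right_mono)
    qed
    have Ln: "L / n \<le> (1 + L) * (1 / n)" using n by (simp add: divide_right_mono)
    have Lr: "L / n \<le> (1 + L) * r" using Ln mult_left_mono[OF rr, of "1 + L"] L by linarith
    have e: "\<epsilon> \<le> (1 + L) * \<epsilon>" using \<epsilon> L by (simp add: distrib_right)
    have "D \<le> 8 * ((1 + L) * \<epsilon>) + 8 * ((1 + L) * r) + 16 * ((1 + L) * r)"
      unfolding D_def using s1 Lr e by linarith
    also have "\<dots> \<le> 24 * ((1 + L) * (r + \<epsilon>))" using \<epsilon> L by (simp add: algebra_simps)
    finally have "A * D \<le> A * (24 * ((1 + L) * (r + \<epsilon>)))" using AB by (intro mult_left_mono) auto
    moreover have "B * D \<le> B * (16 * ((1 + L) * (1 / n + \<epsilon>))) + 16 * ((1 + L) * (A * r))"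
    proof -
      have "B * D = B * (8 * \<epsilon> + 16 * (L / n)) + 8 * (B * sqrt (v * (L / n)))"
        by (simp add: D_def algebra_simps)
      moreover have "8 * \<epsilon> + 16 * (L / n) \<le> 16 * ((1 + L) * (1 / n + \<epsilon>))"
      proof -
        have "16 * ((1 + L) * (1 / n + \<epsilon>)) = 16 * ((1 + L) * (1 / n)) + 16 * ((1 + L) * \<epsilon>)"
          by (simp add: algebra_simps)
        then show ?thesis using Ln e \<epsilon> by linarith
      qed
      then have "B * (8 * \<epsilon> + 16 * (L / n)) \<le> B * (16 * ((1 + L) * (1 / n + \<epsilon>)))"
        using AB by (intro mult_left_mono) auto
      ultimately show ?thesis using s2 by linarith
    qed
    moreover have "16 * ((1 + L) * (A * r)) \<le> A * (16 * ((1 + L) * (r + \<epsilon>)))"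
      using AB L \<epsilon> by (simp add: algebra_simps)
    moreover have "B * (16 * ((1 + L) * (1 / n + \<epsilon>))) \<le> B * (40 * ((1 + L) * (1 / n + \<epsilon>)))"
      using AB L \<epsilon> by (intro mult_left_mono mult_right_mono) auto
    ultimately have "A * D + B * D \<le> A * (40 * ((1 + L) * (r + \<epsilon>))) + B * (40 * ((1 + L) * (1 / n + \<epsilon>)))"
      by (simp add: algebra_simps)
    also have "\<dots> = 40 * (1 + L) * rate n m \<epsilon> p"
    proof -
      have "rate n m \<epsilon> p = A * (r + \<epsilon>) + B * (1 / n + \<epsilon>)"
        by (simp add: rate_def A_def B_def r_def)
      then show ?thesis by algebra
    qed
    finally show ?thesis .
  qed
  finally show ?thesis by (simp add: algebra_simps)
qed

lemma accepts_measurable: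
  "{x \<in> space (sample_distr n m \<epsilon> q Q). \<not> accepts n m \<epsilon>' L j p x} \<in> sets (sample_distr n m \<epsilon> q Q)"
  unfolding accepts_def by measurable

section \<open>Coverage and length\<close>

lemma typical_probability:
  assumes Q: "real_distribution Q" and \<epsilon>: "\<epsilon> \<in> {0..1}" and p: "p \<in> {0..1}" and L: "0 < L" and n: "n \<ge> 1"
  shows "measure (sample_distr n m \<epsilon> p Q) {x \<in> space (sample_distr n m \<epsilon> p Q). \<not> typical n m \<epsilon> L p x}
      \<le> 10 * exp (- L)"
proof -
  let ?N = "sample_distr n m \<epsilon> p Q"
  let ?J = "{cell m p - 2..cell m p + 2}"
  define B where "B j = {x \<in> space ?N. \<not> accepts n m \<epsilon> L j p x}" for j
  have "{x \<in> space ?N. \<not> typical n m \<epsilon> L p x} = (\<Union>j\<in>?J. B j)"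
    by (auto simp: typical_def B_def)
  also have "measure ?N \<dots> \<le> (\<Sum>j\<in>?J. measure ?N (B j))"
    by (intro measure_UNION_le) (auto simp: B_def simp del: sets_sample_distr intro: accepts_measurable)
  also have "\<dots> \<le> (\<Sum>j\<in>?J. 2 * exp (- L))"
    unfolding B_def accepts_def window_mean_def
    by (intro sum_mono empirical_mean_concentration Q \<epsilon> p window_range L n)
  also have "\<dots> = real (card ?J) * (2 * exp (- L))" by simp
  also have "\<dots> \<le> 5 * (2 * exp (- L))" by (intro mult_right_mono) auto
  finally show ?thesis by simp
qed

lemma Prob_ge_if_typical:
  assumes Q: "real_distribution Q" and \<epsilon>: "\<epsilon> \<in> {0..1}" and p: "p \<in> {0..1}" and L: "0 < L" and n: "n \<ge> 1"
    and E: "{x \<in> space (sample_distr n m \<epsilon> p Q). E x} \<in> sets (PiM {..<n} (\<lambda>_. borel))"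
    and imp: "\<And>x. typical n m \<epsilon> L p x \<Longrightarrow> E x"
  shows "Prob n m \<epsilon> p Q E \<ge> 1 - 10 * exp (- L)"
proof -
  let ?N = "sample_distr n m \<epsilon> p Q"
  interpret N: prob_space ?N by (rule prob_space_sample_distr[OF Q \<epsilon>])
  have E': "{x \<in> space ?N. E x} \<in> sets ?N" using E by simp
  have "1 - measure ?N {x \<in> space ?N. E x} = measure ?N (space ?N - {x \<in> space ?N. E x})"
    by (rule N.prob_compl[OF E', symmetric])
  also have "\<dots> \<le> measure ?N {x \<in> space ?N. \<not> typical n m \<epsilon> L p x}"
  proof (intro N.finite_measure_mono)
    have "{x \<in> space ?N. \<not> typical n m \<epsilon> L p x}
        = (\<Union>j\<in>{cell m p - 2..cell m p + 2}. {x \<in> space ?N. \<not> accepts n m \<epsilon> L j p x})"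
      by (auto simp: typical_def)
    also have "\<dots> \<in> sets ?N" by (intro sets.finite_UN accepts_measurable) auto
    finally show "{x \<in> space ?N. \<not> typical n m \<epsilon> L p x} \<in> sets ?N" .
  qed (use imp in auto)
  also have "\<dots> \<le> 10 * exp (- L)" by (rule typical_probability[OF Q \<epsilon> p L n])
  finally show ?thesis by (simp add: Prob_def)
qed

lemma typical_accepted:
  assumes "p \<in> {0..1}" "typical n m \<epsilon> L p x"
  shows "p \<in> accepted_set n m \<epsilon> L x"
  using assms by (auto simp: typical_def accepted_set_def)

lemma robust_ci_covers:
  assumes "p \<in> accepted_set n m \<epsilon> L x"
  shows "p \<in> interval_at (robust_ci n m \<epsilon> L) x"
proof -
  have "bdd_below (accepted_set n m \<epsilon> L x)" "bdd_above (accepted_set n m \<epsilon> L x)"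
    by (auto simp: accepted_set_def intro!: bdd_belowI[of _ 0] bdd_aboveI[of _ 1])
  then show ?thesis
    using assms by (auto simp: interval_at_def robust_ci_def intro: cInf_lower cSup_upper)
qed

lemma robust_ci_length:
  assumes p: "p \<in> accepted_set n m \<epsilon> L x" and R: "0 \<le> R"
    and close: "\<And>q. q \<in> accepted_set n m \<epsilon> L x \<Longrightarrow> \<bar>p - q\<bar> \<le> R"
  shows "interval_len (robust_ci n m \<epsilon> L) x \<le> 2 * R"
proof -
  let ?S = "accepted_set n m \<epsilon> L x"
  have "Sup ?S \<le> p + R" using p close by (intro cSup_least) (force simp: abs_le_iff)+
  moreover have "p - R \<le> Inf ?S" using p close by (intro cInf_greatest) (force simp: abs_le_iff)+
  ultimately show ?thesis using R by (auto simp: interval_len_def robust_ci_def)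
qed

lemma radius_small:
  assumes c: "L / n + \<epsilon> \<le> 4 / 10000" and L: "0 \<le> L" and \<epsilon>: "0 \<le> \<epsilon>" and \<mu>: "0 \<le> \<mu>" "\<mu> \<le> 1"
  shows "radius n \<epsilon> L \<mu> \<le> 1 / 16"
proof -
  have l: "0 \<le> L / n" "L / n \<le> 4 / 10000" using assms by auto
  have "min \<mu> (1 - \<mu>) * (L / n) \<le> 1 * (4 / 10000)"
    using l \<mu> by (intro mult_mono) auto
  then have "sqrt (min \<mu> (1 - \<mu>) * (L / n)) \<le> sqrt ((1 / 50)\<^sup>2)"
    by (intro real_sqrt_le_mono) (simp add: power2_eq_square)
  then have "sqrt (min \<mu> (1 - \<mu>) * (L / n)) \<le> 1 / 50" by (simp only: real_sqrt_abs)
  then have "2 * \<epsilon> + 2 * sqrt (min \<mu> (1 - \<mu>) * (L / n)) + 3 * (L / n) \<le> 1 / 16"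
    using l assms(1) by linarith
  then show ?thesis by (simp add: radius_def)
qed

lemma rate_nonneg: "p \<in> {0..1} \<Longrightarrow> 0 \<le> \<epsilon> \<Longrightarrow> 0 \<le> rate n m \<epsilon> p"
  by (auto simp: rate_def intro!: add_nonneg_nonneg mult_nonneg_nonneg)

lemma robust_ci_optimal:
  assumes \<alpha>: "0 < \<alpha>" "\<alpha> < 1" and nm: "n \<ge> 1" "m \<ge> 1" and \<epsilon>: "\<epsilon> \<in> {0..1}"
    and c0: "ln (2 / \<alpha>) / n + \<epsilon> \<le> 1 / 10000"
  defines "L \<equiv> 4 * ln (2 / \<alpha>)"
  assumes p: "p \<in> {0..1}" and Q: "real_distribution Q"
  shows "Prob n m \<epsilon> p Q (\<lambda>x. p \<in> interval_at (robust_ci n m \<epsilon> L) x) \<ge> 1 - \<alpha>"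
    and "Prob n m \<epsilon> p Q (\<lambda>x. interval_len (robust_ci n m \<epsilon> L) x
           \<le> 80000000 * (1 + L) * rate n m \<epsilon> p) \<ge> 1 - \<alpha>"
proof -
  have L: "0 < L" using \<alpha> by (simp add: L_def)
  \<comment> \<open>The factor \<open>4\<close> in \<open>L\<close> makes the ten tail probabilities of the
    typical event sum to at most \<open>\<alpha>\<close>.\<close>
  have "exp (- ln (2 / \<alpha>)) = \<alpha> / 2" using \<alpha> by (simp add: exp_minus)
  then have "exp (- L) = (\<alpha> / 2) ^ 4"
    unfolding L_def by (metis exp_of_nat_mult mult_minus_right of_nat_numeral)
  also have "\<dots> = \<alpha> * \<alpha> ^ 3 / 16" by (simp add: power_divide eval_nat_numeral)
  also have "\<dots> \<le> \<alpha> * 1 / 16"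
    using \<alpha> by (intro divide_right_mono mult_left_mono power_le_one) auto
  finally have fail: "10 * exp (- L) \<le> \<alpha>" using \<alpha> by simp
  have \<epsilon>0: "0 \<le> \<epsilon>" using \<epsilon> by simp
  have "L / n + \<epsilon> \<le> 4 * (ln (2 / \<alpha>) / n + \<epsilon>)" using \<epsilon>0 by (simp add: L_def)
  also have "\<dots> \<le> 4 * (1 / 10000)" using c0 by (intro mult_left_mono) auto
  finally have c: "L / n + \<epsilon> \<le> 4 / 10000" by simp
  have small: "radius n \<epsilon> L \<mu> \<le> 1 / 16" if "0 \<le> \<mu>" "\<mu> \<le> 1" for \<mu>
    using radius_small[OF c _ \<epsilon>0 that] L by simp
  note meas = interval_measurable_sets[OF robust_ci_in_intervals, of n m \<epsilon> p Q]
  have "1 - 10 * exp (- L) \<le> Prob n m \<epsilon> p Q (\<lambda>x. p \<in> interval_at (robust_ci n m \<epsilon> L) x)"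
    by (rule Prob_ge_if_typical[OF Q \<epsilon> p L nm(1) meas(1)])
       (intro robust_ci_covers typical_accepted p)
  then show "Prob n m \<epsilon> p Q (\<lambda>x. p \<in> interval_at (robust_ci n m \<epsilon> L) x) \<ge> 1 - \<alpha>"
    using fail by linarith
  let ?R = "40000000 * (1 + L) * rate n m \<epsilon> p"
  have R: "0 \<le> ?R" using L rate_nonneg[OF p \<epsilon>0] by simp
  have "interval_len (robust_ci n m \<epsilon> L) x \<le> 80000000 * (1 + L) * rate n m \<epsilon> p"
    if t: "typical n m \<epsilon> L p x" for x
  proof -
    have "interval_len (robust_ci n m \<epsilon> L) x \<le> 2 * ?R"
      using robust_ci_length[OF typical_accepted[OF p t] R]
        accepted_close[OF nm(2,1) \<epsilon>0 _ p _ t small] L by simp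
    then show ?thesis by (simp add: algebra_simps)
  qed
  then have "1 - 10 * exp (- L) \<le> Prob n m \<epsilon> p Q (\<lambda>x. interval_len (robust_ci n m \<epsilon> L) x
           \<le> 80000000 * (1 + L) * rate n m \<epsilon> p)"
    by (rule Prob_ge_if_typical[OF Q \<epsilon> p L nm(1) meas(3)])
  then show "Prob n m \<epsilon> p Q (\<lambda>x. interval_len (robust_ci n m \<epsilon> L) x
           \<le> 80000000 * (1 + L) * rate n m \<epsilon> p) \<ge> 1 - \<alpha>"
    using fail by linarith
qed

theorem proposition1:
  shows "(\<forall>\<alpha>::real. 0 < \<alpha> \<and> \<alpha> < 1 / 4 \<longrightarrow>
           (\<exists>c::real. c > 0 \<and>
             (\<forall>(n::nat) (m::nat) (\<epsilon>::real) (p::real).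
                n \<ge> 1 \<and> m \<ge> 1 \<and> \<epsilon> \<in> {0..1} \<and> p \<in> {0..1} \<longrightarrow>
                  opt_length n m \<alpha> \<epsilon> p \<epsilon> \<ge> c * rate n m \<epsilon> p)))
       \<and> (\<exists>c0::real. c0 > 0 \<and>
           (\<forall>\<alpha>::real. 0 < \<alpha> \<and> \<alpha> < 1 \<longrightarrow>
             (\<exists>C::real. C > 0 \<and>
               (\<forall>(n::nat) (m::nat) (\<epsilon>::real).
                  n \<ge> 1 \<and> m \<ge> 1 \<and> \<epsilon> \<in> {0..1} \<and> ln (2 / \<alpha>) / real n + \<epsilon> \<le> c0 \<longrightarrow>
                    (\<exists>CI \<in> intervals n.
                       (INF (p, Q) \<in> {0..1} \<times> distributions.
                          Prob n m \<epsilon> p Q (\<lambda>x. p \<in> interval_at CI x)) \<ge> 1 - \<alpha> \<and>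
                       (INF (p, Q) \<in> {0..1} \<times> distributions.
                          Prob n m \<epsilon> p Q (\<lambda>x. interval_len CI x \<le> C * rate n m \<epsilon> p)) \<ge> 1 - \<alpha>)))))"
proof (intro conjI allI impI; (elim conjE)?)
  fix \<alpha> :: real assume "0 < \<alpha>" "\<alpha> < 1 / 4"
  then show "\<exists>c::real. c > 0 \<and> (\<forall>(n::nat) (m::nat) (\<epsilon>::real) (p::real).
                n \<ge> 1 \<and> m \<ge> 1 \<and> \<epsilon> \<in> {0..1} \<and> p \<in> {0..1} \<longrightarrow>
                  opt_length n m \<alpha> \<epsilon> p \<epsilon> \<ge> c * rate n m \<epsilon> p)"
    by (intro exI[of _ "1 / 64"] conjI allI impI opt_length_ge_rate) auto
next
  show "\<exists>c0::real. c0 > 0 \<and>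
           (\<forall>\<alpha>::real. 0 < \<alpha> \<and> \<alpha> < 1 \<longrightarrow>
             (\<exists>C::real. C > 0 \<and>
               (\<forall>(n::nat) (m::nat) (\<epsilon>::real).
                  n \<ge> 1 \<and> m \<ge> 1 \<and> \<epsilon> \<in> {0..1} \<and> ln (2 / \<alpha>) / real n + \<epsilon> \<le> c0 \<longrightarrow>
                    (\<exists>CI \<in> intervals n.
                       (INF (p, Q) \<in> {0..1} \<times> distributions.
                          Prob n m \<epsilon> p Q (\<lambda>x. p \<in> interval_at CI x)) \<ge> 1 - \<alpha> \<and>
                       (INF (p, Q) \<in> {0..1} \<times> distributions.
                          Prob n m \<epsilon> p Q (\<lambda>x. interval_len CI x \<le> C * rate n m \<epsilon> p)) \<ge> 1 - \<alpha>))))"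
  proof (rule exI[of _ "1 / 10000"], intro conjI allI impI; (elim conjE)?)
    fix \<alpha> :: real assume \<alpha>: "0 < \<alpha>" "\<alpha> < 1"
    define L where "L = 4 * ln (2 / \<alpha>)"
    show "\<exists>C::real. C > 0 \<and>
               (\<forall>(n::nat) (m::nat) (\<epsilon>::real).
                  n \<ge> 1 \<and> m \<ge> 1 \<and> \<epsilon> \<in> {0..1} \<and> ln (2 / \<alpha>) / real n + \<epsilon> \<le> 1 / 10000 \<longrightarrow>
                    (\<exists>CI \<in> intervals n.
                       (INF (p, Q) \<in> {0..1} \<times> distributions.
                          Prob n m \<epsilon> p Q (\<lambda>x. p \<in> interval_at CI x)) \<ge> 1 - \<alpha> \<and>
                       (INF (p, Q) \<in> {0..1} \<times> distributions.
                          Prob n m \<epsilon> p Q (\<lambda>x. interval_len CI x \<le> C * rate n m \<epsilon> p)) \<ge> 1 - \<alpha>))"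
    proof (intro exI[of _ "80000000 * (1 + L)"] conjI allI impI; (elim conjE)?)
      have "0 < ln (2 / \<alpha>)" using \<alpha> by simp
      then show "0 < 80000000 * (1 + L)" by (simp add: L_def)
      fix n m :: nat and \<epsilon> :: real
      assume *: "n \<ge> 1" "m \<ge> 1" "\<epsilon> \<in> {0..1}" "ln (2 / \<alpha>) / real n + \<epsilon> \<le> 1 / 10000"
      note opt = robust_ci_optimal[OF \<alpha> *, folded L_def]
      show "\<exists>CI \<in> intervals n.
                       (INF (p, Q) \<in> {0..1} \<times> distributions.
                          Prob n m \<epsilon> p Q (\<lambda>x. p \<in> interval_at CI x)) \<ge> 1 - \<alpha> \<and>
                       (INF (p, Q) \<in> {0..1} \<times> distributions.
                          Prob n m \<epsilon> p Q (\<lambda>x. interval_len CI x \<le> 80000000 * (1 + L) * rate n m \<epsilon> p)) \<ge> 1 - \<alpha>"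
        using distributions_nonempty opt
        by (intro bexI[of _ "robust_ci n m \<epsilon> L"] conjI cINF_greatest robust_ci_in_intervals) auto
    qed
  qed simp
qed

end
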